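(* Let $(u^\varepsilon)_{\varepsilon>0}$, for some sequence $\varepsilon\to 0$, be a sequence of solutions $u^\varepsilon\in H^1(\Omega_\varepsilon)$ of $$-\Delta u^\varepsilon-\omega^2u^\varepsilon=f\ \text{ in }\Omega_\varepsilon,\qquad \partial_n u^\varepsilon=0\ \text{ on }\partial\Omega_\varepsilon .$$ Assume that $\|u^\varepsilon\|_{H^1(\Omega_\varepsilon)}$ is bounded uniformly in $\varepsilon$ and that there is $u\in H^1(\Omega_0)$ with $u^\varepsilon|_{\Omega_0}\rightharpoonup u$ weakly in $H^1(\Omega_0)$. Then $u$ is a (weak) solution of $$-\Delta u-\omega^2u=f\ \text{ in }\Omega_0,\qquad \partial_n u=0\ \text{ on }\partial\Omega_0 .$$
   Context: Geometry. Fix real numbers $a,b,L,V,\alpha>0$. Let $I:=(0,a)$, $\Omega_0:=I\times(-b,0)\subset\mathbb{R}^2$. The parameter $\varepsilon>0$ always satisfies $a/\varepsilon\in\mathbb{N}$. Set $$S_\varepsilon:=I\times(L\varepsilon,(L+V)\varepsilon),\qquad C_\varepsilon:=\bigcup_{k=0}^{(a/\varepsilon)-1}(k\varepsilon,k\varepsilon+\alpha\varepsilon^3)\times[0,L\varepsilon],\qquad \Omega_\varepsilon:=\Omega_0\cup S_\varepsilon\cup C_\varepsilon .$$ Data. The frequency $\omega>0$ and $f\in L^2(\mathbb{R}^2)$ are given (independent of $\varepsilon$), and $f$ has support in $\Omega_0$. All functions are real-valued. Solutions are understood in the weak sense: the $\varepsilon$-problem means $\int_{\Omega_\varepsilon}\nabla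 u^\varepsilon\cdot\nabla\varphi-\omega^2\int_{\Omega_\varepsilon}u^\varepsilon\varphi=\int_{\Omega_\varepsilon}f\varphi$ for all $\varphi\in H^1(\Omega_\varepsilon)$, and the limit problem means $\int_{\Omega_0}\nabla u\cdot\nabla\varphi-\omega^2\int_{\Omega_0}u\varphi=\int_{\Omega_0}f\varphi$ for all $\varphi\in H^1(\Omega_0)$. *)

theory Defs
  imports "HOL-Analysis.Analysis"
begin

section \<open>Test functions\<close>

primrec Ck :: "nat \<Rightarrow> ('a::real_normed_vector \<Rightarrow> real) \<Rightarrow> bool" where
  "Ck 0 \<phi> \<longleftrightarrow> continuous_on UNIV \<phi>"
| "Ck (Suc k) \<phi> \<longleftrightarrow>
     (\<forall>x. \<phi> differentiable at x) \<and> (\<forall>v. Ck k (\<lambda>x. frechet_derivative \<phi> (at x) v))"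

definition test_functions :: "'a::real_normed_vector set \<Rightarrow> ('a \<Rightarrow> real) set" where
  "test_functions \<Omega> =
     {\<phi>. (\<forall>k. Ck k \<phi>) \<and> compact (closure {x. \<phi> x \<noteq> 0}) \<and> closure {x. \<phi> x \<noteq> 0} \<subseteq> \<Omega>}"


section \<open>The space \<open>H\<^sup>1\<close>\<close>

text \<open>
  Elements of \<open>L\<^sup>2(\<Omega>)\<close> and \<open>H\<^sup>1(\<Omega>)\<close> are represented by total functions of which only the
  values on \<open>\<Omega>\<close> (up to null sets) are relevant. In particular the restriction of a function to
  a subdomain is represented by the function itself.
\<close>

definition L2 :: "'a::euclidean_space set \<Rightarrow> ('a \<Rightarrow> 'b::euclidean_space) set" where
  "L2 \<Omega> = {u. u \<in> borel_measurable (lebesgue_on \<Omega>) \<and>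
               integrable (lebesgue_on \<Omega>) (\<lambda>x. (norm (u x))\<^sup>2)}"

definition has_weak_gradient ::
    "'a::euclidean_space set \<Rightarrow> ('a \<Rightarrow> real) \<Rightarrow> ('a \<Rightarrow> 'a) \<Rightarrow> bool" where
  "has_weak_gradient \<Omega> u g \<longleftrightarrow>
     (\<forall>\<phi>\<in>test_functions \<Omega>. \<forall>i\<in>Basis.
        (\<integral>x. u x * frechet_derivative \<phi> (at x) i \<partial>lebesgue_on \<Omega>) =
        - (\<integral>x. (g x \<bullet> i) * \<phi> x \<partial>lebesgue_on \<Omega>))"

definition H1 :: "'a::euclidean_space set \<Rightarrow> ('a \<Rightarrow> real) set" where
  "H1 \<Omega> = {u \<in> L2 \<Omega>. \<exists>g\<in>L2 \<Omega>. has_weak_gradient \<Omega> u g}"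

text \<open>On an open set the weak gradient is unique up to a null set, so the choice is immaterial.\<close>

definition weak_grad :: "'a::euclidean_space set \<Rightarrow> ('a \<Rightarrow> real) \<Rightarrow> 'a \<Rightarrow> 'a" where
  "weak_grad \<Omega> u = (SOME g. g \<in> L2 \<Omega> \<and> has_weak_gradient \<Omega> u g)"

definition H1_norm :: "'a::euclidean_space set \<Rightarrow> ('a \<Rightarrow> real) \<Rightarrow> real" where
  "H1_norm \<Omega> u =
     sqrt ((\<integral>x. (u x)\<^sup>2 \<partial>lebesgue_on \<Omega>) + (\<integral>x. (norm (weak_grad \<Omega> u x))\<^sup>2 \<partial>lebesgue_on \<Omega>))"

text \<open>
  Boundedness forces a functional in the dual to agree on functions that are equal almost
  everywhere on \<open>\<Omega>\<close>, so it is a functional on equivalence classes.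
\<close>

definition H1_dual :: "'a::euclidean_space set \<Rightarrow> (('a \<Rightarrow> real) \<Rightarrow> real) set" where
  "H1_dual \<Omega> =
     {F. (\<forall>u\<in>H1 \<Omega>. \<forall>v\<in>H1 \<Omega>. F (\<lambda>x. u x + v x) = F u + F v) \<and>
         (\<forall>c. \<forall>u\<in>H1 \<Omega>. F (\<lambda>x. c * u x) = c * F u) \<and>
         (\<exists>C. \<forall>u\<in>H1 \<Omega>. \<bar>F u\<bar> \<le> C * H1_norm \<Omega> u)}"

definition H1_weakly_converges ::
    "'a::euclidean_space set \<Rightarrow> (nat \<Rightarrow> 'a \<Rightarrow> real) \<Rightarrow> ('a \<Rightarrow> real) \<Rightarrow> bool" where
  "H1_weakly_converges \<Omega> U u \<longleftrightarrow>
     (\<forall>n. U n \<in> H1 \<Omega>) \<and> u \<in> H1 \<Omega> \<and> (\<forall>F\<in>H1_dual \<Omega>. (\<lambda>n. F (U n)) \<longlonglongrightarrow> F u)"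


section \<open>The Neumann problem for the Helmholtz equation\<close>

definition neumann_helmholtz_solution ::
    "'a::euclidean_space set \<Rightarrow> real \<Rightarrow> ('a \<Rightarrow> real) \<Rightarrow> ('a \<Rightarrow> real) \<Rightarrow> bool" where
  "neumann_helmholtz_solution \<Omega> \<omega> f u \<longleftrightarrow>
     u \<in> H1 \<Omega> \<and>
     (\<forall>\<phi>\<in>H1 \<Omega>.
        (\<integral>x. weak_grad \<Omega> u x \<bullet> weak_grad \<Omega> \<phi> x \<partial>lebesgue_on \<Omega>)
          - \<omega>\<^sup>2 * (\<integral>x. u x * \<phi> x \<partial>lebesgue_on \<Omega>)
        = (\<integral>x. f x * \<phi> x \<partial>lebesgue_on \<Omega>))"


section \<open>Geometry\<close>

definition Omega0 :: "real \<Rightarrow> real \<Rightarrow> (real \<times> real) set" where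
  "Omega0 a b = {0<..<a} \<times> {-b<..<0}"

definition S_eps :: "real \<Rightarrow> real \<Rightarrow> real \<Rightarrow> real \<Rightarrow> (real \<times> real) set" where
  "S_eps a L V \<epsilon> = {0<..<a} \<times> {L * \<epsilon> <..< (L + V) * \<epsilon>}"

definition C_eps :: "real \<Rightarrow> real \<Rightarrow> real \<Rightarrow> real \<Rightarrow> (real \<times> real) set" where
  "C_eps a L \<alpha> \<epsilon> =
     (\<Union>k\<in>{k::nat. real k \<le> a / \<epsilon> - 1}.
        {real k * \<epsilon> <..< real k * \<epsilon> + \<alpha> * \<epsilon> ^ 3} \<times> {0..L * \<epsilon>})"

text \<open>
  This set is open as soon as \<open>\<alpha> * \<epsilon>\<^sup>2 \<le> 1\<close>, hence for all but finitely many members of a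
  sequence of values of \<open>\<epsilon>\<close> that tends to 0.
\<close>

definition Omega_eps :: "real \<Rightarrow> real \<Rightarrow> real \<Rightarrow> real \<Rightarrow> real \<Rightarrow> real \<Rightarrow> (real \<times> real) set" where
  "Omega_eps a b L V \<alpha> \<epsilon> = Omega0 a b \<union> S_eps a L V \<epsilon> \<union> C_eps a L \<alpha> \<epsilon>"

end

theory Submission
  imports Defs
begin

text \<open>
  No traces and no density of smooth functions are needed. Given \<open>\<phi> \<in> H\<^sup>1(\<Omega>\<^sub>0)\<close>, reflect it evenly
  across the upper side \<open>y = 0\<close>. The reflection \<open>\<Phi>\<close> is an \<open>H\<^sup>1\<close> function on the rectangle
  \<open>(0, a) \<times> (-b, b)\<close> (lemma \<open>has_weak_gradient_even_reflection\<close>), and for small \<open>\<epsilon>\<close> this rectangle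
  contains \<open>\<Omega>\<^sub>\<epsilon>\<close> (lemma \<open>Omega_eps_geometry\<close>). Hence \<open>\<Phi>\<close> is a fixed admissible test function in every
  \<open>\<epsilon>\<close>-problem with small \<open>\<epsilon>\<close>. On \<open>\<Omega>\<^sub>0\<close> the tested equation involves only the restriction of
  \<open>u\<^sup>\<epsilon>\<close>, and the corresponding expression (\<open>helmholtz_form\<close>) is a bounded linear functional on
  \<open>H\<^sup>1(\<Omega>\<^sub>0)\<close>, so weak convergence applies (lemma \<open>helmholtz_form_H1_dual\<close>). The remaining set
  \<open>\<Omega>\<^sub>\<epsilon> - \<Omega>\<^sub>0\<close> lies in the strip \<open>0 \<le> y \<le> (L + V) \<epsilon>\<close>; by Cauchy-Schwarz its contribution is at most
  the uniform bound on \<open>u\<^sup>\<epsilon>\<close> times the norm of \<open>\<Phi>\<close> and \<open>\<nabla>\<Phi>\<close> on that strip, which tends to \<open>0\<close> by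
  dominated convergence. In particular the oscillating geometry of the channels plays no role.

  Two facts about weak gradients carry the argument. The weak gradient on an open set is unique almost
  everywhere (lemma \<open>weak_gradient_unique\<close>, from the fundamental lemma of the calculus of variations),
  so the chosen representative \<open>weak_grad\<close> is, almost everywhere, additive and compatible with
  restriction to open subsets. The reflection has the reflected field as its weak gradient: folding the
  integral back onto \<open>\<Omega>\<^sub>0\<close> replaces a test function \<open>\<psi>\<close> by its even part for the tangential derivative, and by its odd
  part for the normal one; neither needs to vanish near \<open>y = 0\<close>, so they are multiplied by cut-off functions
  of \<open>y\<close>. The cut-off commutes with the tangential derivative, and the odd part vanishes at \<open>y = 0\<close>
  to first order, which compensates the growth of the normal derivative of the cut-off. All smooth
  functions that occur are built from \<open>exp (-1/t)\<close>.
\<close>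

section \<open>Smooth functions\<close>

lemma Ck_SucD: "Ck (Suc k) f \<Longrightarrow> Ck k f"
proof (induction k arbitrary: f)
  case 0
  then show ?case
    by (auto simp: continuous_on_eq_continuous_at intro: differentiable_imp_continuous_within)
next
  case (Suc k)
  have "Ck k (\<lambda>x. frechet_derivative f (at x) v)" for v
    using Suc.prems by (intro Suc.IH) simp
  moreover have "f differentiable at x" for x
    using Suc.prems by simp
  ultimately show ?case by simp
qed

lemma Ck_1D:
  assumes "Ck 1 f"
  shows "f differentiable at x" "continuous_on UNIV (\<lambda>x. frechet_derivative f (at x) v)"
  using assms by auto

lemma Ck_const: "Ck k (\<lambda>x. c)"
  by (induction k arbitrary: c) auto

lemma Ck_add: "Ck k f \<Longrightarrow> Ck k g \<Longrightarrow> Ck k (\<lambda>x. f x + g x)"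
proof (induction k arbitrary: f g)
  case 0
  then show ?case by (auto intro: continuous_intros)
next
  case (Suc k)
  then have d: "f differentiable at x" "g differentiable at x" for x by auto
  have "((\<lambda>x. f x + g x) has_derivative (\<lambda>v. frechet_derivative f (at x) v
        + frechet_derivative g (at x) v)) (at x)" for x
    using d[of x] unfolding frechet_derivative_works by (rule has_derivative_add)
  note D = fun_cong[OF frechet_derivative_at[OF this, symmetric]]
  show ?case using Suc d by (simp add: D)
qed

lemma Ck_mult: "Ck k f \<Longrightarrow> Ck k g \<Longrightarrow> Ck k (\<lambda>x. f x * g x)"
proof (induction k arbitrary: f g)
  case 0
  then show ?case by (auto intro: continuous_intros)
next
  case (Suc k)
  have d: "f differentiable at x" "g differentiable at x" for x using Suc.prems by auto
  have "((\<lambda>x. f x * g x) has_derivative (\<lambda>v. f x * frechet_derivative g (at x) v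
        + frechet_derivative f (at x) v * g x)) (at x)" for x
    using d[of x] unfolding frechet_derivative_works by (rule has_derivative_mult)
  note D = fun_cong[OF frechet_derivative_at[OF this, symmetric]]
  have "Ck k (\<lambda>x. f x * frechet_derivative g (at x) v + frechet_derivative f (at x) v * g x)" for v
    using Suc.prems Ck_SucD[OF Suc.prems(1)] Ck_SucD[OF Suc.prems(2)]
    by (intro Ck_add Suc.IH) auto
  then show ?case using d by (simp add: D)
qed

lemma Ck_prod: "(\<And>i. i \<in> I \<Longrightarrow> Ck k (f i)) \<Longrightarrow> Ck k (\<lambda>x. \<Prod>i\<in>I. f i x)"
  by (induction I rule: infinite_finite_induct) (auto simp: Ck_const Ck_mult)

lemma frechet_derivative_compose_affine:
  fixes f :: "'b::real_normed_vector \<Rightarrow> real"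
  assumes "bounded_linear A" "f differentiable at (A x + c)"
  shows "(\<lambda>x. f (A x + c)) differentiable at x"
    "frechet_derivative (\<lambda>x. f (A x + c)) (at x) v = frechet_derivative f (at (A x + c)) (A v)"
proof -
  have "((\<lambda>x. A x + c) has_derivative A) (at x)"
    using assms(1) by (auto intro!: derivative_eq_intros bounded_linear_imp_has_derivative)
  from has_derivative_compose[OF this assms(2)[unfolded frechet_derivative_works]]
  have *: "((\<lambda>x. f (A x + c)) has_derivative (\<lambda>v. frechet_derivative f (at (A x + c)) (A v))) (at x)" .
  show "(\<lambda>x. f (A x + c)) differentiable at x"
    using * by (rule differentiableI)
  show "frechet_derivative (\<lambda>x. f (A x + c)) (at x) v = frechet_derivative f (at (A x + c)) (A v)"
    by (rule fun_cong[OF frechet_derivative_at[OF *, symmetric]])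
qed

lemma Ck_compose_affine:
  fixes f :: "'b::real_normed_vector \<Rightarrow> real"
  assumes "bounded_linear A" "Ck k f"
  shows "Ck k (\<lambda>x. f (A x + c))"
  using assms(2)
proof (induction k arbitrary: f)
  case 0
  then show ?case
    using linear_continuous_on[OF assms(1)]
    by (auto intro!: continuous_on_compose2[of UNIV f] continuous_intros)
next
  case (Suc k)
  then have d: "f differentiable at x" for x by auto
  have "Ck k (\<lambda>x. frechet_derivative f (at (A x + c)) (A v))" for v
    using Suc.prems by (intro Suc.IH) auto
  then show ?case
    using frechet_derivative_compose_affine[OF assms(1) d] by simp
qed

section \<open>Smooth functions that are flat at the origin\<close>

text \<open>
  The functions \<open>p(1/t) exp (-1/t)\<close> for \<open>t > 0\<close>, extended by \<open>0\<close> to \<open>t \<le> 0\<close>. Admitting a polynomial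
  factor \<open>p\<close> makes the class closed under differentiation, which gives smoothness by induction.
\<close>
definition flat :: "real poly \<Rightarrow> real \<Rightarrow> real" where
  "flat p t = (if t \<le> 0 then 0 else poly p (1/t) * exp (- (1/t)))"

lemma poly_times_exp_tendsto_0: "((\<lambda>s::real. poly p s * exp (- s)) \<longlongrightarrow> 0) at_top"
proof -
  have "((\<lambda>s::real. \<Sum>i\<le>degree p. coeff p i * (s ^ i / exp s)) \<longlongrightarrow>
      (\<Sum>i\<le>degree p. coeff p i * 0)) at_top"
    by (intro tendsto_intros tendsto_power_div_exp_0)
  moreover have "(\<lambda>s::real. \<Sum>i\<le>degree p. coeff p i * (s ^ i / exp s)) = (\<lambda>s. poly p s * exp (- s))"
    unfolding poly_altdef sum_distrib_right by (simp add: exp_minus field_simps)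
  ultimately show ?thesis by simp
qed

lemma flat_has_derivative:
  "(flat p has_real_derivative flat ([:0,0,1:] * (p - pderiv p)) t) (at t)"
proof (cases t "0::real" rule: linorder_cases)
  case less
  have "((\<lambda>t. 0) has_real_derivative flat ([:0,0,1:] * (p - pderiv p)) t) (at t)"
    using less by (simp add: flat_def)
  then show ?thesis
    by (rule has_field_derivative_transform_within_open[of _ _ _ "{..<0}"])
      (use less in \<open>auto simp: flat_def\<close>)
next
  case greater
  have "((\<lambda>t. poly p (1/t) * exp (- (1/t))) has_real_derivative
     flat ([:0,0,1:] * (p - pderiv p)) t) (at t)"
    using greater by (auto intro!: derivative_eq_intros DERIV_chain2[OF poly_DERIV]
      simp: flat_def field_simps power2_eq_square)
  then show ?thesis
    by (rule has_field_derivative_transform_within_open[of _ _ _ "{0<..}"])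
      (use greater in \<open>auto simp: flat_def\<close>)
next
  case equal
  \<comment> \<open>Both one-sided limits of the difference quotient at \<open>0\<close> vanish.\<close>
  have "((\<lambda>h. poly ([:0,1:] * p) (inverse h) * exp (- inverse h)) \<longlongrightarrow> 0) (at_right 0)"
    by (rule filterlim_compose[OF poly_times_exp_tendsto_0 filterlim_inverse_at_top_right])
  then have "((\<lambda>h. flat p h / h) \<longlongrightarrow> 0) (at_right 0)"
    by (rule Lim_transform_eventually)
      (auto simp: flat_def field_simps eventually_at_right_less intro!: eventually_at_rightI[of 0 1])
  moreover have "((\<lambda>h. flat p h / h) \<longlongrightarrow> 0) (at_left 0)"
    by (rule Lim_transform_eventually[OF tendsto_const])
      (auto simp: flat_def intro!: eventually_at_leftI[of "-1" 0])
  ultimately show ?thesis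
    using equal by (simp add: DERIV_def filterlim_split_at flat_def)
qed

lemma Ck_flat: "Ck k (flat p)"
proof (induction k arbitrary: p)
  case 0
  show ?case
    using DERIV_isCont[OF flat_has_derivative] by (simp add: continuous_on_eq_continuous_at)
next
  case (Suc k)
  let ?q = "[:0,0,1:] * (p - pderiv p)"
  have *: "(flat p has_derivative (\<lambda>v. flat ?q t * v)) (at t)" for t
    using flat_has_derivative[of p t] by (simp only: has_field_derivative_def)
  have "frechet_derivative (flat p) (at t) v = flat ?q t * v" for t v
    by (rule fun_cong[OF frechet_derivative_at[OF *, symmetric]])
  then show ?case
    using * Suc.IH[of ?q] by (auto simp: differentiable_def intro!: Ck_mult Ck_const)
qed

section \<open>Test functions and their derivatives\<close>

lemma test_functionsD:
  assumes "\<phi> \<in> test_functions \<Omega>"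
  shows "Ck k \<phi>" "\<phi> differentiable at x" "continuous_on UNIV \<phi>"
    "continuous_on UNIV (\<lambda>x. frechet_derivative \<phi> (at x) v)"
    "compact (closure {x. \<phi> x \<noteq> 0})" "closure {x. \<phi> x \<noteq> 0} \<subseteq> \<Omega>"
proof -
  show k: "Ck k \<phi>" for k using assms by (auto simp: test_functions_def)
  from k[of 0] show "continuous_on UNIV \<phi>" by simp
  from k[of 1] show "\<phi> differentiable at x" "continuous_on UNIV (\<lambda>x. frechet_derivative \<phi> (at x) v)"
    by auto
  show "compact (closure {x. \<phi> x \<noteq> 0})" "closure {x. \<phi> x \<noteq> 0} \<subseteq> \<Omega>"
    using assms by (auto simp: test_functions_def)
qed

lemma test_functions_mono: "A \<subseteq> B \<Longrightarrow> test_functions A \<subseteq> test_functions B"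
  by (auto simp: test_functions_def)

lemma vanishing_off_support:
  fixes \<phi> :: "'a::real_normed_vector \<Rightarrow> real"
  assumes "x \<notin> closure {x. \<phi> x \<noteq> 0}"
  shows "\<phi> x = 0" "frechet_derivative \<phi> (at x) v = 0"
proof -
  have *: "\<phi> y = 0" if "y \<notin> closure {x. \<phi> x \<noteq> 0}" for y
  proof (rule ccontr)
    assume "\<phi> y \<noteq> 0"
    then have "y \<in> {x. \<phi> x \<noteq> 0}" by (rule CollectI)
    from subsetD[OF closure_subset this] that show False by contradiction
  qed
  show "\<phi> x = 0" by (rule *[OF assms])
  have "(\<phi> has_derivative (\<lambda>_. 0)) (at x)"
    by (rule has_derivative_transform_within_open[of "\<lambda>_. 0" _ _ _ "- closure {x. \<phi> x \<noteq> 0}"])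
      (use assms in \<open>simp_all only: * open_Compl closed_closure Compl_iff simp_thms has_derivative_const\<close>)
  from fun_cong[OF frechet_derivative_at[OF this, symmetric]]
  show "frechet_derivative \<phi> (at x) v = 0" .
qed

lemma bounded_if_compact_support:
  fixes g :: "'a::real_normed_vector \<Rightarrow> real"
  assumes "continuous_on UNIV g" "compact S" "\<And>x. x \<notin> S \<Longrightarrow> g x = 0"
  obtains M where "M \<ge> 0" "\<And>x. \<bar>g x\<bar> \<le> M"
proof -
  have "bounded (g ` S)"
    using assms by (intro compact_imp_bounded compact_continuous_image) (auto intro: continuous_on_subset)
  then obtain M where "\<And>x. x \<in> S \<Longrightarrow> \<bar>g x\<bar> \<le> M"
    by (auto simp: bounded_iff)
  with assms(3) have "\<bar>g x\<bar> \<le> max M 0" for x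
    by (cases "x \<in> S") (auto simp: le_max_iff_disj)
  then show thesis using that[of "max M 0"] by auto
qed

lemma test_function_bounds:
  assumes "\<phi> \<in> test_functions \<Omega>"
  obtains M where "M \<ge> 0" "\<And>x. \<bar>\<phi> x\<bar> \<le> M" "\<And>x. \<bar>frechet_derivative \<phi> (at x) v\<bar> \<le> M"
proof -
  note T = test_functionsD[OF assms]
  obtain M where "\<And>x. \<bar>\<phi> x\<bar> \<le> M"
    using bounded_if_compact_support[OF T(3,5)] vanishing_off_support by metis
  moreover obtain M' where "\<And>x. \<bar>frechet_derivative \<phi> (at x) v\<bar> \<le> M'"
    using bounded_if_compact_support[OF T(4,5)] vanishing_off_support by metis
  ultimately show thesis
    using that[of "max (max M M') 0"] by (auto simp: le_max_iff_disj)
qed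

section \<open>Square integrable functions\<close>

lemma integrable_inner_if_square_integrable:
  fixes u v :: "'a \<Rightarrow> 'b::euclidean_space"
  assumes [measurable]: "u \<in> borel_measurable M" "v \<in> borel_measurable M"
    and "integrable M (\<lambda>x. (norm (u x))\<^sup>2)" "integrable M (\<lambda>x. (norm (v x))\<^sup>2)"
  shows "integrable M (\<lambda>x. u x \<bullet> v x)" "integrable M (\<lambda>x. norm (u x) * norm (v x))"
proof -
  have i: "integrable M (\<lambda>x. (norm (u x))\<^sup>2 + (norm (v x))\<^sup>2)" using assms by simp
  have *: "norm x * norm y \<le> (norm x)\<^sup>2 + (norm y)\<^sup>2" for x y :: 'b
    using sum_squares_bound[of "norm x" "norm y"] mult_nonneg_nonneg[OF norm_ge_zero[of x] norm_ge_zero[of y]]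
    by linarith
  then have **: "\<bar>x \<bullet> y\<bar> \<le> (norm x)\<^sup>2 + (norm y)\<^sup>2" for x y :: 'b
    using Cauchy_Schwarz_ineq2[of x y] order_trans by blast
  show "integrable M (\<lambda>x. u x \<bullet> v x)"
    by (rule Bochner_Integration.integrable_bound[OF i]) (use ** in auto)
  show "integrable M (\<lambda>x. norm (u x) * norm (v x))"
    by (rule Bochner_Integration.integrable_bound[OF i]) (use * in auto)
qed

lemma Cauchy_Schwarz_integral:
  fixes u v :: "'a \<Rightarrow> 'b::euclidean_space"
  assumes [measurable]: "u \<in> borel_measurable M" "v \<in> borel_measurable M"
    and u: "integrable M (\<lambda>x. (norm (u x))\<^sup>2)" and v: "integrable M (\<lambda>x. (norm (v x))\<^sup>2)"
  shows "\<bar>\<integral>x. u x \<bullet> v x \<partial>M\<bar> \<le> sqrt (\<integral>x. (norm (u x))\<^sup>2 \<partial>M) * sqrt (\<integral>x. (norm (v x))\<^sup>2 \<partial>M)"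
proof -
  note I = integrable_inner_if_square_integrable[OF assms]
  have "ennreal ((\<integral>x. norm (u x) * norm (v x) \<partial>M)\<^sup>2) = (\<integral>\<^sup>+x. ennreal (norm (u x)) * ennreal (norm (v x)) \<partial>M)\<^sup>2"
    by (subst ennreal_mult[symmetric], simp, simp, subst nn_integral_eq_integral[OF I(2)])
      (simp_all add: ennreal_power integral_nonneg_AE)
  also have "\<dots> \<le> (\<integral>\<^sup>+x. (ennreal (norm (u x)))\<^sup>2 \<partial>M) * (\<integral>\<^sup>+x. (ennreal (norm (v x)))\<^sup>2 \<partial>M)"
    by (rule Cauchy_Schwarz_nn_integral) auto
  also have "\<dots> = ennreal ((\<integral>x. (norm (u x))\<^sup>2 \<partial>M) * (\<integral>x. (norm (v x))\<^sup>2 \<partial>M))"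
    by (simp add: ennreal_power nn_integral_eq_integral u v ennreal_mult integral_nonneg_AE)
  finally have "(\<integral>x. norm (u x) * norm (v x) \<partial>M)\<^sup>2 \<le> (\<integral>x. (norm (u x))\<^sup>2 \<partial>M) * (\<integral>x. (norm (v x))\<^sup>2 \<partial>M)"
    by (subst (asm) ennreal_le_iff) (auto intro!: mult_nonneg_nonneg integral_nonneg_AE)
  then have "(\<integral>x. norm (u x) * norm (v x) \<partial>M) \<le> sqrt (\<integral>x. (norm (u x))\<^sup>2 \<partial>M) * sqrt (\<integral>x. (norm (v x))\<^sup>2 \<partial>M)"
    by (simp add: real_le_rsqrt flip: real_sqrt_mult)
  moreover have "\<bar>\<integral>x. u x \<bullet> v x \<partial>M\<bar> \<le> (\<integral>x. norm (u x) * norm (v x) \<partial>M)"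
    by (rule order_trans[OF integral_abs_bound integral_mono])
      (use I Cauchy_Schwarz_ineq2 in auto)
  ultimately show ?thesis by linarith
qed

lemma L2D:
  assumes "u \<in> L2 \<Omega>"
  shows "u \<in> borel_measurable (lebesgue_on \<Omega>)" "integrable (lebesgue_on \<Omega>) (\<lambda>x. (norm (u x))\<^sup>2)"
  using assms by (auto simp: L2_def)

lemma L2_inner_integrable:
  "u \<in> L2 \<Omega> \<Longrightarrow> v \<in> L2 \<Omega> \<Longrightarrow> integrable (lebesgue_on \<Omega>) (\<lambda>x. u x \<bullet> v x)"
  by (intro integrable_inner_if_square_integrable L2D)

lemma L2_Cauchy_Schwarz:
  "u \<in> L2 \<Omega> \<Longrightarrow> v \<in> L2 \<Omega> \<Longrightarrow> \<bar>\<integral>x. u x \<bullet> v x \<partial>lebesgue_on \<Omega>\<bar> \<le>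
     sqrt (\<integral>x. (norm (u x))\<^sup>2 \<partial>lebesgue_on \<Omega>) * sqrt (\<integral>x. (norm (v x))\<^sup>2 \<partial>lebesgue_on \<Omega>)"
  by (intro Cauchy_Schwarz_integral L2D)

lemma L2_add:
  assumes u: "u \<in> L2 \<Omega>" and v: "v \<in> L2 \<Omega>" shows "(\<lambda>x. u x + v x) \<in> L2 \<Omega>"
proof -
  have "integrable (lebesgue_on \<Omega>) (\<lambda>x. (norm (u x))\<^sup>2 + 2 * (u x \<bullet> v x) + (norm (v x))\<^sup>2)"
    using L2D[OF u] L2D[OF v] L2_inner_integrable[OF u v] by auto
  then show ?thesis
    using L2D(1)[OF u] L2D(1)[OF v]
    by (auto simp: L2_def power2_norm_eq_inner algebra_simps inner_commute)
qed

lemma L2_scaleR: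
  assumes "u \<in> L2 \<Omega>" shows "(\<lambda>x. c *\<^sub>R u x) \<in> L2 \<Omega>"
  using L2D[OF assms] by (auto simp: L2_def power_mult_distrib)

lemma L2_inner_const:
  assumes "u \<in> L2 \<Omega>" shows "(\<lambda>x. u x \<bullet> c) \<in> L2 \<Omega>"
proof -
  note [measurable] = L2D(1)[OF assms]
  have i: "integrable (lebesgue_on \<Omega>) (\<lambda>x. (norm c)\<^sup>2 * (norm (u x))\<^sup>2)"
    using L2D[OF assms] by auto
  have *: "(x \<bullet> c)\<^sup>2 \<le> (norm c)\<^sup>2 * (norm x)\<^sup>2" for x :: 'b
    using power_mono[OF Cauchy_Schwarz_ineq2[of x c] abs_ge_zero, of 2]
    by (simp add: power_mult_distrib mult.commute)
  have "integrable (lebesgue_on \<Omega>) (\<lambda>x. (u x \<bullet> c)\<^sup>2)"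
  proof (rule Bochner_Integration.integrable_bound[OF i])
    show "AE x in lebesgue_on \<Omega>. norm ((u x \<bullet> c)\<^sup>2) \<le> norm ((norm c)\<^sup>2 * (norm (u x))\<^sup>2)"
      using * by (intro AE_I2) simp
  qed measurable
  then show ?thesis using L2D(1)[OF assms] by (auto simp: L2_def)
qed

lemma integrable_lebesgue_on_subset:
  fixes f :: "'a::euclidean_space \<Rightarrow> 'b::{banach, second_countable_topology}"
  assumes "A \<subseteq> B" "A \<in> sets lebesgue" "B \<in> sets lebesgue" "integrable (lebesgue_on B) f"
  shows "integrable (lebesgue_on A) f"
  using set_integrable_subset[of lebesgue B f A] assms
  by (simp add: integrable_restrict_space set_integrable_def)

lemma L2_subset:
  assumes "A \<subseteq> B" "A \<in> sets lebesgue" "B \<in> sets lebesgue" "u \<in> L2 B"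
  shows "u \<in> L2 A"
  using L2D[OF assms(4)] integrable_lebesgue_on_subset[OF assms(1-3)] measurable_restrict_mono[OF _ assms(1)]
  by (auto simp: L2_def)

lemma integral_lebesgue_on_subset:
  fixes f :: "'a::euclidean_space \<Rightarrow> 'b::{banach, second_countable_topology}"
  assumes "A \<subseteq> B" "A \<in> sets lebesgue" "B \<in> sets lebesgue" "\<And>x. x \<in> B - A \<Longrightarrow> f x = 0"
  shows "(\<integral>x. f x \<partial>lebesgue_on B) = (\<integral>x. f x \<partial>lebesgue_on A)"
proof -
  have "indicator B x *\<^sub>R f x = indicator A x *\<^sub>R f x" for x
    using assms by (auto simp: indicator_def)
  then have "(\<lambda>x. indicator B x *\<^sub>R f x) = (\<lambda>x. indicator A x *\<^sub>R f x)" by blast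
  moreover have "A \<inter> space lebesgue \<in> sets lebesgue" "B \<inter> space lebesgue \<in> sets lebesgue"
    using assms by auto
  ultimately show ?thesis by (simp only: integral_restrict_space)
qed

lemma continuous_borel_measurable_lebesgue_on:
  fixes g :: "'a::euclidean_space \<Rightarrow> 'b::topological_space"
  shows "continuous_on UNIV g \<Longrightarrow> g \<in> borel_measurable (lebesgue_on \<Omega>)"
  by (intro measurable_restrict_space1 borel_measurable_continuous_onI measurable_completion)
    (simp add: borel_measurable_continuous_onI)

lemma L2_if_compact_support:
  fixes \<Omega> :: "'a::euclidean_space set" and g :: "'a \<Rightarrow> real"
  assumes \<Omega>: "\<Omega> \<in> sets lebesgue" and g: "continuous_on UNIV g"
    "compact S" "\<And>x. x \<notin> S \<Longrightarrow> g x = 0"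
  shows "g \<in> L2 \<Omega>"
proof -
  note [measurable] = continuous_borel_measurable_lebesgue_on[OF g(1)]
  obtain M where M: "\<And>x. \<bar>g x\<bar> \<le> M" using bounded_if_compact_support[OF g] by metis
  have S: "S \<in> lmeasurable" using lmeasurable_compact g(2) by blast
  have "integrable lebesgue (\<lambda>x. M\<^sup>2 * indicator S x)"
    using S by (intro integrable_mult_right) (intro integrable_real_indicator; simp add: fmeasurable_def del: emeasure_completion)
  then have "integrable lebesgue (\<lambda>x. (g x)\<^sup>2)"
  proof (rule Bochner_Integration.integrable_bound)
    show "(\<lambda>x. (g x)\<^sup>2) \<in> borel_measurable lebesgue"
      using continuous_borel_measurable_lebesgue_on[OF g(1), of UNIV]
      unfolding lebesgue_on_UNIV_eq by measurable
    have "(g x)\<^sup>2 \<le> M\<^sup>2" for x using M[of x] by (metis abs_ge_zero power2_abs power_mono)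
    then show "AE x in lebesgue. norm ((g x)\<^sup>2) \<le> norm (M\<^sup>2 * indicator S x)"
      using g(3) by (intro AE_I2) (auto simp: indicator_def)
  qed
  then have "integrable (lebesgue_on \<Omega>) (\<lambda>x. (g x)\<^sup>2)"
    using integrable_lebesgue_on_subset[of \<Omega> UNIV "\<lambda>x. (g x)\<^sup>2"] \<Omega> by (simp add: lebesgue_on_UNIV_eq)
  then show ?thesis by (simp add: L2_def continuous_borel_measurable_lebesgue_on[OF g(1)])
qed

lemma test_function_L2:
  assumes "\<phi> \<in> test_functions \<Omega>'" "\<Omega> \<in> sets lebesgue"
  shows "\<phi> \<in> L2 \<Omega>" "(\<lambda>x. frechet_derivative \<phi> (at x) v) \<in> L2 \<Omega>"
  using test_functionsD[OF assms(1)] assms(2) vanishing_off_support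
  by (auto intro!: L2_if_compact_support[of _ _ "closure {x. \<phi> x \<noteq> 0}"])

section \<open>The fundamental lemma of the calculus of variations\<close>

text \<open>
  A smooth function that is positive exactly on the open box between \<open>c\<close> and \<open>d\<close> (for \<open>n > 0\<close>) and
  increases to the indicator of that box as \<open>n\<close> tends to infinity.
\<close>
definition bump :: "'a::euclidean_space \<Rightarrow> 'a \<Rightarrow> nat \<Rightarrow> 'a \<Rightarrow> real" where
  "bump c d n x = (\<Prod>i\<in>Basis. flat 1 (real n * (x \<bullet> i - c \<bullet> i)) * flat 1 (real n * (d \<bullet> i - x \<bullet> i)))"

lemma flat_1_bounds: "0 \<le> flat 1 t" "flat 1 t \<le> 1"
  by (auto simp: flat_def)

lemma flat_1_tendsto: "(flat 1 \<longlongrightarrow> 1) at_top"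
proof -
  have "((\<lambda>t::real. exp (- inverse t)) \<longlongrightarrow> exp (- 0)) at_top"
    by (intro tendsto_intros tendsto_inverse_0_at_top filterlim_ident)
  then show ?thesis
    unfolding minus_zero exp_zero
    by (rule Lim_transform_eventually)
      (auto simp: flat_def inverse_eq_divide intro: eventually_mono[OF eventually_gt_at_top[of 0]])
qed

lemma Ck_bump: "Ck k (bump c d n)"
proof -
  have 1: "Ck k (\<lambda>x. flat 1 (real n * (x \<bullet> i - c \<bullet> i)))" for i
    using Ck_compose_affine[OF bounded_linear_const_mult[OF bounded_linear_inner_left[of i], of "real n"]
        Ck_flat[of k 1], of "- real n * (c \<bullet> i)"]
    by (simp add: algebra_simps)
  have 2: "Ck k (\<lambda>x. flat 1 (real n * (d \<bullet> i - x \<bullet> i)))" for i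
    using Ck_compose_affine[OF bounded_linear_const_mult[OF bounded_linear_inner_left[of i], of "- real n"]
        Ck_flat[of k 1], of "real n * (d \<bullet> i)"]
    by (simp add: algebra_simps)
  show ?thesis unfolding bump_def by (intro Ck_prod Ck_mult 1 2)
qed

lemma bump_zero: "x \<notin> box c d \<Longrightarrow> bump c d n x = 0"
proof -
  assume "x \<notin> box c d"
  then obtain i where i: "i \<in> Basis" "x \<bullet> i - c \<bullet> i \<le> 0 \<or> d \<bullet> i - x \<bullet> i \<le> 0"
    by (force simp: mem_box not_less)
  have "flat 1 (real n * t) = 0" if "t \<le> 0" for t
    using that by (simp add: flat_def mult_nonneg_nonpos)
  with i have "flat 1 (real n * (x \<bullet> i - c \<bullet> i)) * flat 1 (real n * (d \<bullet> i - x \<bullet> i)) = 0"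
    by (metis mult_eq_0_iff)
  with i(1) show ?thesis unfolding bump_def
    by (intro prod_zero finite_Basis bexI)
qed

lemma bump_bounds: "\<bar>bump c d n x\<bar> \<le> 1"
  unfolding bump_def abs_prod abs_mult
  by (intro prod_le_1) (auto simp: flat_1_bounds intro!: mult_le_one)

lemma bump_tendsto: "x \<in> box c d \<Longrightarrow> (\<lambda>n. bump c d n x) \<longlonglongrightarrow> 1"
proof -
  assume x: "x \<in> box c d"
  have *: "(\<lambda>n. flat 1 (real n * t)) \<longlonglongrightarrow> 1" if "t > 0" for t
    by (rule filterlim_compose[OF flat_1_tendsto])
      (simp only: mult.commute[of _ t], rule filterlim_tendsto_pos_mult_at_top[OF tendsto_const that filterlim_real_sequentially])
  have "(\<lambda>n. bump c d n x) \<longlonglongrightarrow> (\<Prod>i\<in>(Basis::'a set). 1 * 1)"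
    unfolding bump_def by (intro tendsto_prod tendsto_mult *) (use x in \<open>auto simp: mem_box\<close>)
  then show ?thesis by simp
qed

lemma bump_test_functions:
  assumes "cbox c d \<subseteq> \<Omega>" shows "bump c d n \<in> test_functions \<Omega>"
proof -
  have "{x. bump c d n x \<noteq> 0} \<subseteq> cbox c d"
    using bump_zero box_subset_cbox by blast
  then have "closure {x. bump c d n x \<noteq> 0} \<subseteq> cbox c d"
    using closed_cbox by (rule closure_minimal)
  then show ?thesis using assms Ck_bump
    by (auto simp: test_functions_def intro: compact_closure[THEN iffD2] bounded_subset[OF bounded_cbox] dest: order_trans[OF closure_subset])
qed

lemma integral_box_zero:
  assumes \<Omega>: "open \<Omega>" and w: "w \<in> L2 \<Omega>"
    and zero: "\<And>\<phi>. \<phi> \<in> test_functions \<Omega> \<Longrightarrow> (\<integral>x. w x * \<phi> x \<partial>lebesgue_on \<Omega>) = 0"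
    and cd: "cbox c d \<subseteq> \<Omega>"
  shows "integrable lebesgue (\<lambda>x. indicator (box c d) x * w x)"
    "(\<integral>x. indicator (box c d) x * w x \<partial>lebesgue) = (0::real)"
proof -
  have sub: "box c d \<subseteq> \<Omega>" using cd box_subset_cbox by blast
  have \<Omega>s: "\<Omega> \<in> sets lebesgue" using \<Omega> by auto
  have "w \<in> L2 (box c d)" using L2_subset[OF sub] w \<Omega>s by simp
  note wL = L2D[OF this]
  have "finite_measure (lebesgue_on (box c d))"
    by (intro finite_measure_lebesgue_on) simp
  from finite_measure.square_integrable_imp_integrable[OF this wL(1)] wL(2)
  have "integrable (lebesgue_on (box c d)) w" by simp
  then show i: "integrable lebesgue (\<lambda>x. indicator (box c d) x * w x)"
    by (simp add: integrable_restrict_space)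
  have "(\<integral>x. w x * bump c d n x \<partial>lebesgue_on (box c d)) = 0" for n
    using zero[OF bump_test_functions[OF cd, of n]] integral_lebesgue_on_subset[OF sub _ \<Omega>s, of "\<lambda>x. w x * bump c d n x"]
      bump_zero by fastforce
  then have 0: "(\<integral>x. indicator (box c d) x * (w x * bump c d n x) \<partial>lebesgue) = 0" for n
    by (simp add: integral_restrict_space)
  have "(\<lambda>n. \<integral>x. indicator (box c d) x * (w x * bump c d n x) \<partial>lebesgue) \<longlonglongrightarrow>
     (\<integral>x. indicator (box c d) x * w x \<partial>lebesgue)"
  proof (rule integral_dominated_convergence)
    show "(\<lambda>x. indicator (box c d) x * w x) \<in> borel_measurable lebesgue" using i by auto
    have "bump c d n \<in> borel_measurable lebesgue" for n
      using continuous_borel_measurable_lebesgue_on[OF test_functionsD(3)[OF bump_test_functions[OF cd, of n]], where \<Omega>=UNIV]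
      by (simp add: lebesgue_on_UNIV_eq)
    then show "(\<lambda>x. indicator (box c d) x * (w x * bump c d n x)) \<in> borel_measurable lebesgue" for n
      using borel_measurable_times[OF borel_measurable_integrable[OF i], of "bump c d n"] by (simp add: mult.assoc)
    show "integrable lebesgue (\<lambda>x. \<bar>indicator (box c d) x * w x\<bar>)" using i by simp
    show "AE x in lebesgue. (\<lambda>n. indicator (box c d) x * (w x * bump c d n x)) \<longlonglongrightarrow> indicator (box c d) x * w x"
      using bump_tendsto by (auto simp: indicator_def intro!: AE_I2 tendsto_eq_intros)
    show "AE x in lebesgue. norm (indicator (box c d) x * (w x * bump c d n x)) \<le> \<bar>indicator (box c d) x * w x\<bar>" for n
      using bump_bounds by (auto simp: abs_mult intro!: AE_I2 mult_left_le mult_left_mono)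
  qed
  then show "(\<integral>x. indicator (box c d) x * w x \<partial>lebesgue) = 0"
    unfolding 0 using LIMSEQ_const_iff by metis
qed

text \<open>
  The hypothesis on the total integral serves for complements in the induction over the Borel sets.
\<close>
lemma AE_zero_if_box_integrals_zero:
  fixes W :: "'a::euclidean_space \<Rightarrow> real"
  assumes W: "integrable lebesgue W" and W0: "(\<integral>x. W x \<partial>lebesgue) = 0"
    and box: "\<And>p q. (\<integral>x. indicator (box p q) x * W x \<partial>lebesgue) = 0"
  shows "AE x in lebesgue. W x = 0"
proof -
  \<comment> \<open>Borel sets suffice after passing to a Borel measurable representative.\<close>
  obtain W' where W'[measurable]: "W' \<in> borel_measurable lborel" and AE: "AE x in lborel. W x = W' x"
    using completion_ex_borel_measurable_real[of W lborel] W by auto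
  have AE': "AE x in lebesgue. W x = W' x" using AE by (rule AE_completion)
  have [measurable]: "W \<in> borel_measurable lebesgue" "W' \<in> borel_measurable lebesgue"
    using W W' by (auto intro: measurable_completion)
  have iW': "integrable lborel W'"
    using W integrable_cong_AE[OF _ _ AE'] integrable_completion[OF W'] by simp
  have iA: "integrable lborel (\<lambda>x. indicator A x * W' x)" if "A \<in> sets borel" for A
    using integrable_mult_indicator[OF _ iW', of A] that by simp
  have eq: "(\<integral>x. indicator A x * W' x \<partial>lborel) = (\<integral>x. indicator A x * W x \<partial>lebesgue)"
    if [measurable]: "A \<in> sets borel" for A
  proof -
    have [measurable]: "A \<in> sets lebesgue" using that by auto
    have "(\<integral>x. indicator A x * W' x \<partial>lborel) = (\<integral>x. indicator A x * W' x \<partial>lebesgue)"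
      by (rule integral_completion[symmetric]) measurable
    also have "\<dots> = (\<integral>x. indicator A x * W x \<partial>lebesgue)"
      by (rule integral_cong_AE) (use AE' in auto)
    finally show ?thesis .
  qed
  have tot: "(\<integral>x. W' x \<partial>lborel) = 0" using eq[of UNIV] W0 by simp
  have "(\<integral>x. indicator A x * W' x \<partial>lborel) = 0" if "A \<in> sets borel" for A
  proof -
    have "Int_stable (range (\<lambda>(a, b). box a b :: 'a set))"
      by (auto simp: Int_stable_def box_Int_box)
    moreover have "range (\<lambda>(a, b). box a b :: 'a set) \<subseteq> Pow UNIV" by simp
    moreover have "A \<in> sigma_sets UNIV (range (\<lambda>(a, b). box a b :: 'a set))"
      using that by (simp add: borel_eq_box)
    ultimately show ?thesis
    proof (induct rule: sigma_sets_induct_disjoint)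
      case (basic A) then show ?case using eq box by auto
    next
      case empty show ?case by simp
    next
      case (compl A)
      then have A: "A \<in> sets borel" by (simp add: borel_eq_box)
      have "(\<integral>x. indicator (UNIV - A) x * W' x \<partial>lborel) = (\<integral>x. W' x - indicator A x * W' x \<partial>lborel)"
        by (intro Bochner_Integration.integral_cong) (auto simp: indicator_def)
      also have "\<dots> = 0" using iA[OF A] iW' tot compl by simp
      finally show ?case .
    next
      case (union A)
      then have A: "A i \<in> sets borel" for i by (auto simp: borel_eq_box)
      have "(\<integral>x\<in>(\<Union>i. A i). W' x \<partial>lborel) = (\<Sum>i. \<integral>x\<in>A i. W' x \<partial>lborel)"
        using A union iA[of "\<Union>i. A i"]
        by (intro lebesgue_integral_countable_add) (auto simp: set_integrable_def disjoint_family_on_def)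
      then show ?case using union by (simp add: set_lebesgue_integral_def)
    qed
  qed
  then have "AE x in lborel. W' x = 0"
    by (intro sigma_finite_measure.density_zero[OF sigma_finite_lborel] iW') (simp add: set_lebesgue_integral_def)
  then have "AE x in lborel. W x = 0" using AE by auto
  then show ?thesis by (rule AE_completion)
qed

text \<open>
  The integral of \<open>w\<close> over every box whose closure lies in \<open>\<Omega>\<close> vanishes, because the indicator of the
  box is a bounded limit of test functions; the boxes generate the Borel sets, and countably many of
  them cover \<open>\<Omega>\<close>.
\<close>
lemma fundamental_lemma:
  fixes w :: "'a::euclidean_space \<Rightarrow> real"
  assumes \<Omega>: "open \<Omega>" and w: "w \<in> L2 \<Omega>"
    and zero: "\<And>\<phi>. \<phi> \<in> test_functions \<Omega> \<Longrightarrow> (\<integral>x. w x * \<phi> x \<partial>lebesgue_on \<Omega>) = 0"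
  shows "AE x in lebesgue_on \<Omega>. w x = 0"
proof -
  define \<F> where "\<F> = {box c d |c d. cbox c d \<subseteq> \<Omega>}"
  obtain \<F>' where F': "\<F>' \<subseteq> \<F>" "countable \<F>'" "\<Union>\<F>' = \<Union>\<F>"
  proof (rule Lindelof)
    show "open S" if "S \<in> \<F>" for S using that open_box unfolding \<F>_def by blast
  qed
  have F: "\<Union>\<F> = \<Omega>"
  proof
    show "\<Union>\<F> \<subseteq> \<Omega>" using box_subset_cbox unfolding \<F>_def by blast
    show "\<Omega> \<subseteq> \<Union>\<F>"
    proof
      fix x assume "x \<in> \<Omega>"
      from open_contains_cbox[OF \<Omega> this] obtain c d where "cbox c d \<subseteq> \<Omega>" "x \<in> box c d" by metis
      then show "x \<in> \<Union>\<F>" unfolding \<F>_def by blast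
    qed
  qed
  have "AE x in lebesgue. x \<in> B \<longrightarrow> w x = 0" if B_in: "B \<in> \<F>" for B
  proof -
    obtain c d where B: "B = box c d" and cd: "cbox c d \<subseteq> \<Omega>" using B_in unfolding \<F>_def by blast
    have "(\<integral>x. indicator (box p q) x * (indicator (box c d) x * w x) \<partial>lebesgue) = 0" for p q
    proof -
      \<comment> \<open>Boxes are stable under intersection, so \<open>integral_box_zero\<close> applies to the smaller box.\<close>
      obtain r s where rs: "box p q \<inter> box c d = box r s" by (auto simp: box_Int_box)
      then have *: "indicator (box p q) x * (indicator (box c d) x * w x) = indicator (box r s) x * w x" for x
        unfolding rs[symmetric] by (auto simp: indicator_def)
      show ?thesis
      proof (cases "box r s = {}")
        case False
        then have "cbox r s \<subseteq> \<Omega>"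
          using closure_box[OF False] closure_mono[of "box r s" "cbox c d"] box_subset_cbox[of c d] rs cd by auto
        from integral_box_zero(2)[OF \<Omega> w zero this] show ?thesis unfolding * .
      qed (simp add: *)
    qed
    from AE_zero_if_box_integrals_zero[OF integral_box_zero[OF \<Omega> w zero cd] this]
    show ?thesis by (auto simp: B indicator_def)
  qed
  then have "AE x in lebesgue. \<forall>B\<in>\<F>'. x \<in> B \<longrightarrow> w x = 0"
    using F' by (intro AE_ball_countable[THEN iffD2]) auto
  then have "AE x in lebesgue. x \<in> \<Omega> \<longrightarrow> w x = 0"
    using F F'(3) by (elim AE_mp) (auto intro!: AE_I2)
  then show ?thesis using \<Omega> by (simp add: AE_restrict_space_iff)
qed

section \<open>Weak gradients\<close>

lemma weak_gradient_unique:
  fixes g1 g2 :: "'a::euclidean_space \<Rightarrow> 'a"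
  assumes \<Omega>: "open \<Omega>" and g: "g1 \<in> L2 \<Omega>" "g2 \<in> L2 \<Omega>"
    and w: "has_weak_gradient \<Omega> u g1" "has_weak_gradient \<Omega> u g2"
  shows "AE x in lebesgue_on \<Omega>. g1 x = g2 x"
proof -
  have \<Omega>s: "\<Omega> \<in> sets lebesgue" using \<Omega> by auto
  have "AE x in lebesgue_on \<Omega>. (g1 x + (-1) *\<^sub>R g2 x) \<bullet> i = 0" if i: "i \<in> Basis" for i
  proof (rule fundamental_lemma[OF \<Omega>])
    show "(\<lambda>x. (g1 x + (-1) *\<^sub>R g2 x) \<bullet> i) \<in> L2 \<Omega>"
      by (intro L2_inner_const L2_add L2_scaleR g)
    fix \<phi> assume \<phi>: "\<phi> \<in> test_functions \<Omega>"
    have "integrable (lebesgue_on \<Omega>) (\<lambda>x. (g x \<bullet> i) * \<phi> x)" if "g \<in> L2 \<Omega>" for g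
      using L2_inner_integrable[OF L2_inner_const[OF that, of i] test_function_L2(1)[OF \<phi> \<Omega>s]] by simp
    note I = this[OF g(1)] this[OF g(2)]
    have "(\<integral>x. (g1 x \<bullet> i) * \<phi> x \<partial>lebesgue_on \<Omega>) = (\<integral>x. (g2 x \<bullet> i) * \<phi> x \<partial>lebesgue_on \<Omega>)"
      using w[unfolded has_weak_gradient_def, THEN bspec, OF \<phi>, THEN bspec, OF i] by linarith
    then show "(\<integral>x. ((g1 x + (-1) *\<^sub>R g2 x) \<bullet> i) * \<phi> x \<partial>lebesgue_on \<Omega>) = 0"
      using I by (simp add: inner_diff_left left_diff_distrib)
  qed
  then have "AE x in lebesgue_on \<Omega>. \<forall>i\<in>Basis. (g1 x + (-1) *\<^sub>R g2 x) \<bullet> i = 0"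
    by (intro AE_ball_countable[THEN iffD2]) (auto intro: countable_finite)
  then show ?thesis
    by (rule eventually_mono) (rule euclidean_eqI, simp add: inner_diff_left)
qed

lemma weak_grad:
  assumes "u \<in> H1 \<Omega>"
  shows "weak_grad \<Omega> u \<in> L2 \<Omega>" "has_weak_gradient \<Omega> u (weak_grad \<Omega> u)"
proof -
  have "\<exists>g. g \<in> L2 \<Omega> \<and> has_weak_gradient \<Omega> u g" using assms by (auto simp: H1_def)
  from someI_ex[OF this]
  show "weak_grad \<Omega> u \<in> L2 \<Omega>" "has_weak_gradient \<Omega> u (weak_grad \<Omega> u)"
    unfolding weak_grad_def by auto
qed

lemma H1_I: "u \<in> L2 \<Omega> \<Longrightarrow> g \<in> L2 \<Omega> \<Longrightarrow> has_weak_gradient \<Omega> u g \<Longrightarrow> u \<in> H1 \<Omega>"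
  by (auto simp: H1_def)

lemma H1_imp_L2: "u \<in> H1 \<Omega> \<Longrightarrow> u \<in> L2 \<Omega>"
  by (auto simp: H1_def)

lemma weak_grad_AE_eq:
  assumes "open \<Omega>" "u \<in> H1 \<Omega>" "g \<in> L2 \<Omega>" "has_weak_gradient \<Omega> u g"
  shows "AE x in lebesgue_on \<Omega>. weak_grad \<Omega> u x = g x"
  using weak_gradient_unique[OF assms(1) weak_grad(1)[OF assms(2)] assms(3) weak_grad(2)[OF assms(2)] assms(4)] .

lemma has_weak_gradient_subset:
  fixes A B :: "'a::euclidean_space set"
  assumes "has_weak_gradient B u g" "A \<subseteq> B" "A \<in> sets lebesgue" "B \<in> sets lebesgue"
  shows "has_weak_gradient A u g"
  unfolding has_weak_gradient_def
proof (intro ballI)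
  fix \<phi> :: "'a \<Rightarrow> real" and i :: 'a
  assume \<phi>: "\<phi> \<in> test_functions A" and i: "i \<in> Basis"
  have v: "\<phi> x = 0 \<and> frechet_derivative \<phi> (at x) i = 0" if "x \<in> B - A" for x
    using vanishing_off_support[of x \<phi>] test_functionsD(6)[OF \<phi>] that by blast
  have "(\<integral>x. u x * frechet_derivative \<phi> (at x) i \<partial>lebesgue_on A) =
      (\<integral>x. u x * frechet_derivative \<phi> (at x) i \<partial>lebesgue_on B)"
    using v by (intro integral_lebesgue_on_subset[symmetric] assms) simp
  also have "\<dots> = - (\<integral>x. (g x \<bullet> i) * \<phi> x \<partial>lebesgue_on B)"
    using assms(1) i \<phi> test_functions_mono[OF assms(2)] by (auto simp: has_weak_gradient_def)
  also have "(\<integral>x. (g x \<bullet> i) * \<phi> x \<partial>lebesgue_on B) = (\<integral>x. (g x \<bullet> i) * \<phi> x \<partial>lebesgue_on A)"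
    using v by (intro integral_lebesgue_on_subset assms) simp
  finally show "(\<integral>x. u x * frechet_derivative \<phi> (at x) i \<partial>lebesgue_on A) = - (\<integral>x. (g x \<bullet> i) * \<phi> x \<partial>lebesgue_on A)" .
qed

lemma has_weak_gradient_add:
  fixes \<Omega> :: "'a::euclidean_space set"
  assumes \<Omega>: "\<Omega> \<in> sets lebesgue" and L: "u \<in> L2 \<Omega>" "v \<in> L2 \<Omega>" "g \<in> L2 \<Omega>" "h \<in> L2 \<Omega>"
    and w: "has_weak_gradient \<Omega> u g" "has_weak_gradient \<Omega> v h"
  shows "has_weak_gradient \<Omega> (\<lambda>x. u x + v x) (\<lambda>x. g x + h x)"
  unfolding has_weak_gradient_def
proof (intro ballI)
  fix \<phi> :: "'a \<Rightarrow> real" and i :: 'a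
  assume \<phi>: "\<phi> \<in> test_functions \<Omega>" and i: "i \<in> Basis"
  note T = test_function_L2[OF \<phi> \<Omega>]
  have 1: "integrable (lebesgue_on \<Omega>) (\<lambda>x. f x * frechet_derivative \<phi> (at x) i)" if "f \<in> L2 \<Omega>" for f
    using L2_inner_integrable[OF that T(2)[of i]] by simp
  have 2: "integrable (lebesgue_on \<Omega>) (\<lambda>x. (f x \<bullet> i) * \<phi> x)" if "f \<in> L2 \<Omega>" for f
    using L2_inner_integrable[OF L2_inner_const[OF that, of i] T(1)] by simp
  show "(\<integral>x. (u x + v x) * frechet_derivative \<phi> (at x) i \<partial>lebesgue_on \<Omega>) =
        - (\<integral>x. ((g x + h x) \<bullet> i) * \<phi> x \<partial>lebesgue_on \<Omega>)"
    using w \<phi> i 1[OF L(1)] 1[OF L(2)] 2[OF L(3)] 2[OF L(4)]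
    by (simp add: has_weak_gradient_def inner_add_left distrib_right)
qed

lemma has_weak_gradient_cmult:
  fixes \<Omega> :: "'a::euclidean_space set"
  assumes "has_weak_gradient \<Omega> u g"
  shows "has_weak_gradient \<Omega> (\<lambda>x. c * u x) (\<lambda>x. c *\<^sub>R g x)"
  using assms by (simp add: has_weak_gradient_def mult.assoc)

lemma H1_norm_bounds:
  shows "sqrt (\<integral>x. (u x)\<^sup>2 \<partial>lebesgue_on \<Omega>) \<le> H1_norm \<Omega> u"
    and "sqrt (\<integral>x. (norm (weak_grad \<Omega> u x))\<^sup>2 \<partial>lebesgue_on \<Omega>) \<le> H1_norm \<Omega> u"
  unfolding H1_norm_def by (auto intro!: real_sqrt_le_mono integral_nonneg_AE)

text \<open>
  The left-hand side of the weak formulation, as a functional of the solution \<open>v\<close> for a fixed test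
  function \<open>\<phi>\<close>.
\<close>
definition helmholtz_form :: "'a::euclidean_space set \<Rightarrow> real \<Rightarrow> ('a \<Rightarrow> real) \<Rightarrow> ('a \<Rightarrow> real) \<Rightarrow> real" where
  "helmholtz_form \<Omega> \<omega> \<phi> v = (\<integral>x. weak_grad \<Omega> v x \<bullet> weak_grad \<Omega> \<phi> x \<partial>lebesgue_on \<Omega>)
      - \<omega>\<^sup>2 * (\<integral>x. v x * \<phi> x \<partial>lebesgue_on \<Omega>)"

text \<open>
  Linearity depends on the uniqueness of weak gradients, as \<open>weak_grad\<close> selects its value on a sum
  independently of its values on the summands.
\<close>
lemma helmholtz_form_H1_dual:
  fixes \<Omega> :: "'a::euclidean_space set"
  assumes \<Omega>: "open \<Omega>" and \<phi>: "\<phi> \<in> H1 \<Omega>"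
  shows "helmholtz_form \<Omega> \<omega> \<phi> \<in> H1_dual \<Omega>"
proof -
  have \<Omega>s: "\<Omega> \<in> sets lebesgue" using \<Omega> by auto
  note G = weak_grad(1)[OF \<phi>] and L = H1_imp_L2[OF \<phi>]
  have int: "integrable (lebesgue_on \<Omega>) (\<lambda>x. weak_grad \<Omega> v x \<bullet> weak_grad \<Omega> \<phi> x)"
     "integrable (lebesgue_on \<Omega>) (\<lambda>x. v x * \<phi> x)" if "v \<in> H1 \<Omega>" for v
    using L2_inner_integrable[OF weak_grad(1)[OF that] G] L2_inner_integrable[OF H1_imp_L2[OF that] L]
    by auto
  \<comment> \<open>Any weak gradient of \<open>v\<close> may replace the selected one.\<close>
  have cong: "(\<integral>x. weak_grad \<Omega> v x \<bullet> weak_grad \<Omega> \<phi> x \<partial>lebesgue_on \<Omega>) = (\<integral>x. g x \<bullet> weak_grad \<Omega> \<phi> x \<partial>lebesgue_on \<Omega>)"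
    if "v \<in> L2 \<Omega>" "g \<in> L2 \<Omega>" "has_weak_gradient \<Omega> v g" for v g
  proof (rule integral_cong_AE)
    have v: "v \<in> H1 \<Omega>" using H1_I that by blast
    show "(\<lambda>x. weak_grad \<Omega> v x \<bullet> weak_grad \<Omega> \<phi> x) \<in> borel_measurable (lebesgue_on \<Omega>)" using int v by blast
    show "(\<lambda>x. g x \<bullet> weak_grad \<Omega> \<phi> x) \<in> borel_measurable (lebesgue_on \<Omega>)"
      using L2_inner_integrable[OF that(2) G] by blast
    show "AE x in lebesgue_on \<Omega>. weak_grad \<Omega> v x \<bullet> weak_grad \<Omega> \<phi> x = g x \<bullet> weak_grad \<Omega> \<phi> x"
      using weak_grad_AE_eq[OF \<Omega> v that(2,3)] by auto
  qed
  have add: "helmholtz_form \<Omega> \<omega> \<phi> (\<lambda>x. u x + v x) = helmholtz_form \<Omega> \<omega> \<phi> u + helmholtz_form \<Omega> \<omega> \<phi> v"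
    if u: "u \<in> H1 \<Omega>" and v: "v \<in> H1 \<Omega>" for u v
  proof -
    note u' = H1_imp_L2[OF u] weak_grad[OF u] and v' = H1_imp_L2[OF v] weak_grad[OF v]
    show ?thesis unfolding helmholtz_form_def
      using int[OF u] int[OF v]
      by (simp add: cong[OF L2_add[OF u'(1) v'(1)] L2_add[OF u'(2) v'(2)]
         has_weak_gradient_add[OF \<Omega>s u'(1) v'(1) u'(2) v'(2) u'(3) v'(3)]] inner_add_left algebra_simps)
  qed
  have cm: "helmholtz_form \<Omega> \<omega> \<phi> (\<lambda>x. c * u x) = c * helmholtz_form \<Omega> \<omega> \<phi> u"
    if u: "u \<in> H1 \<Omega>" for u c
  proof -
    note u' = H1_imp_L2[OF u] weak_grad[OF u]
    have "(\<lambda>x. c * u x) \<in> L2 \<Omega>" using L2_scaleR[OF u'(1), of c] by simp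
    from cong[OF this L2_scaleR[OF u'(2)] has_weak_gradient_cmult[OF u'(3)]]
    show ?thesis unfolding helmholtz_form_def by (simp add: algebra_simps)
  qed
  define A where "A = sqrt (\<integral>x. (norm (weak_grad \<Omega> \<phi> x))\<^sup>2 \<partial>lebesgue_on \<Omega>)"
  define B where "B = sqrt (\<integral>x. (norm (\<phi> x))\<^sup>2 \<partial>lebesgue_on \<Omega>)"
  have AB: "A \<ge> 0" "B \<ge> 0" unfolding A_def B_def by auto
  have "\<bar>helmholtz_form \<Omega> \<omega> \<phi> u\<bar> \<le> (A + \<omega>\<^sup>2 * B) * H1_norm \<Omega> u" if u: "u \<in> H1 \<Omega>" for u
  proof -
    have "\<bar>\<integral>x. weak_grad \<Omega> u x \<bullet> weak_grad \<Omega> \<phi> x \<partial>lebesgue_on \<Omega>\<bar> \<le> H1_norm \<Omega> u * A"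
      using L2_Cauchy_Schwarz[OF weak_grad(1)[OF u] G] mult_right_mono[OF H1_norm_bounds(2) AB(1)]
      unfolding A_def by (rule order_trans)
    moreover have "\<bar>\<integral>x. u x * \<phi> x \<partial>lebesgue_on \<Omega>\<bar> \<le> H1_norm \<Omega> u * B"
      using L2_Cauchy_Schwarz[OF H1_imp_L2[OF u] L] mult_right_mono[OF H1_norm_bounds(1)[of \<Omega> u] AB(2)]
      unfolding B_def by (simp)
    then have "\<omega>\<^sup>2 * \<bar>\<integral>x. u x * \<phi> x \<partial>lebesgue_on \<Omega>\<bar> \<le> \<omega>\<^sup>2 * (H1_norm \<Omega> u * B)"
      by (intro mult_left_mono) auto
    then have "\<bar>\<omega>\<^sup>2 * (\<integral>x. u x * \<phi> x \<partial>lebesgue_on \<Omega>)\<bar> \<le> \<omega>\<^sup>2 * (H1_norm \<Omega> u * B)"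
      by (simp add: abs_mult)
    ultimately show ?thesis unfolding helmholtz_form_def
      by (simp add: algebra_simps)
  qed
  with add cm show ?thesis unfolding H1_dual_def by blast
qed

section \<open>Even reflection across the upper side of the rectangle\<close>

text \<open>The reflection of the plane in the line \<open>y = 0\<close> that contains the upper side of \<open>\<Omega>\<^sub>0\<close>.\<close>
definition mirror :: "real \<times> real \<Rightarrow> real \<times> real" where
  "mirror p = (fst p, - snd p)"

lemma mirror_mirror [simp]: "mirror (mirror p) = p" by (simp add: mirror_def)

lemma snd_mirror [simp]: "snd (mirror p) = - snd p" by (simp add: mirror_def)

lemma norm_mirror [simp]: "norm (mirror p) = norm p"
  by (simp add: mirror_def norm_prod_def)

lemma bounded_linear_mirror: "bounded_linear mirror"
  unfolding mirror_def[abs_def]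
  by (intro bounded_linear_Pair bounded_linear_fst bounded_linear_minus bounded_linear_snd)

lemma Basis_plane: "Basis = {(1, 0), (0, 1) :: real \<times> real}"
  by (auto simp: Basis_prod_def)

lemma lebesgue_mirror:
  shows "mirror \<in> lebesgue \<rightarrow>\<^sub>M lebesgue" "distr lebesgue lebesgue mirror = lebesgue"
proof -
  define c :: "real \<times> real \<Rightarrow> real" where "c j = (if j = (1, 0) then 1 else -1)" for j
  have c: "c j \<noteq> 0" for j by (simp add: c_def)
  have T: "mirror = (\<lambda>x. 0 + (\<Sum>j\<in>Basis. (c j * (x \<bullet> j)) *\<^sub>R j))"
    by (auto simp: mirror_def Basis_plane c_def fun_eq_iff inner_prod_def)
  show "mirror \<in> lebesgue \<rightarrow>\<^sub>M lebesgue"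
    unfolding T by (rule lebesgue_affine_measurable) (rule c)
  have p: "(\<Prod>j\<in>Basis. \<bar>c j\<bar>) = 1" by (rule prod.neutral) (auto simp: c_def)
  show "distr lebesgue lebesgue mirror = lebesgue"
    using lebesgue_affine_euclidean[of c 0, OF c, folded T] p by (simp add: density_1)
qed

lemma integral_mirror:
  fixes f :: "real \<times> real \<Rightarrow> 'b::{banach, second_countable_topology}"
  shows "f \<in> borel_measurable lebesgue \<Longrightarrow> (\<integral>x. f (mirror x) \<partial>lebesgue) = (\<integral>x. f x \<partial>lebesgue)"
  using integral_distr[OF lebesgue_mirror(1), of f] lebesgue_mirror(2) by metis

lemma integrable_mirror:
  fixes f :: "real \<times> real \<Rightarrow> 'b::{banach, second_countable_topology}"
  shows "integrable lebesgue f \<Longrightarrow> integrable lebesgue (\<lambda>x. f (mirror x))"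
  using integrable_distr[OF lebesgue_mirror(1), of f] lebesgue_mirror(2) by metis

lemma L2_UNIV_mirror:
  assumes "u \<in> L2 UNIV" shows "(\<lambda>x. u (mirror x)) \<in> L2 UNIV"
  using measurable_compose[OF lebesgue_mirror(1) L2D(1)[OF assms, unfolded lebesgue_on_UNIV_eq]]
    integrable_mirror[OF L2D(2)[OF assms, unfolded lebesgue_on_UNIV_eq]]
  unfolding L2_def lebesgue_on_UNIV_eq by simp

lemma L2_indicator:
  fixes u :: "'a::euclidean_space \<Rightarrow> 'b::euclidean_space"
  assumes "u \<in> L2 \<Omega>" "\<Omega> \<in> sets lebesgue"
  shows "(\<lambda>x. indicator \<Omega> x *\<^sub>R u x) \<in> L2 UNIV"
proof -
  have *: "(norm (indicator \<Omega> x *\<^sub>R u x))\<^sup>2 = indicator \<Omega> x *\<^sub>R (norm (u x))\<^sup>2" for x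
    by (simp add: indicator_def)
  show ?thesis
    using L2D[OF assms(1)] assms(2) unfolding L2_def lebesgue_on_UNIV_eq mem_Collect_eq *
    by (simp add: borel_measurable_restrict_space_iff integrable_restrict_space)
qed

text \<open>
  The even reflection of \<open>\<phi>\<close>, for \<open>\<Omega>\<close> below the line \<open>y = 0\<close>. It is extended by \<open>0\<close> to the rest of the
  plane, in particular to the line itself, so that it is a globally square integrable function.
\<close>
definition even_reflection :: "(real \<times> real) set \<Rightarrow> (real \<times> real \<Rightarrow> real) \<Rightarrow> real \<times> real \<Rightarrow> real" where
  "even_reflection \<Omega> \<phi> x = indicator \<Omega> x * \<phi> x + indicator \<Omega> (mirror x) * \<phi> (mirror x)"

text \<open>
  The gradient of the even reflection: \<open>g\<close> on \<open>\<Omega>\<close>, the image under \<open>mirror\<close> of \<open>g \<circ> mirror\<close> on the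
  mirror image of \<open>\<Omega>\<close>, and \<open>0\<close> elsewhere.
\<close>
definition reflected_field :: "(real \<times> real) set \<Rightarrow> (real \<times> real \<Rightarrow> real \<times> real) \<Rightarrow> real \<times> real \<Rightarrow> real \<times> real" where
  "reflected_field \<Omega> g x = indicator \<Omega> x *\<^sub>R g x + mirror (indicator \<Omega> (mirror x) *\<^sub>R g (mirror x))"

lemma L2_even_reflection:
  assumes "\<phi> \<in> L2 \<Omega>" "\<Omega> \<in> sets lebesgue" shows "even_reflection \<Omega> \<phi> \<in> L2 UNIV"
  using L2_add[OF L2_indicator[OF assms] L2_UNIV_mirror[OF L2_indicator[OF assms]]]
  by (simp add: even_reflection_def[abs_def])

lemma L2_mirror_comp:
  assumes "g \<in> L2 \<Omega>" shows "(\<lambda>x. mirror (g x)) \<in> L2 \<Omega>"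
proof -
  have "mirror \<in> borel_measurable borel"
    using bounded_linear_mirror by (intro borel_measurable_continuous_onI linear_continuous_on)
  from measurable_compose[OF L2D(1)[OF assms] this] L2D(2)[OF assms] show ?thesis
    by (simp add: L2_def)
qed

lemma L2_reflected_field:
  assumes "g \<in> L2 \<Omega>" "\<Omega> \<in> sets lebesgue" shows "reflected_field \<Omega> g \<in> L2 UNIV"
  using L2_add[OF L2_indicator[OF assms] L2_mirror_comp[OF L2_UNIV_mirror[OF L2_indicator[OF assms]]]]
  by (simp add: reflected_field_def[abs_def])

section \<open>Cut-off near the upper side\<close>

text \<open>
  A smooth function of \<open>y\<close> with values in \<open>[0, 1]\<close> that vanishes for \<open>y \<ge> -1/n\<close> (when \<open>n > 0\<close>) and
  tends to \<open>1\<close> for every \<open>y < 0\<close> as \<open>n\<close> tends to infinity. It need not be equal to \<open>1\<close> anywhere.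
\<close>
definition cutoff :: "nat \<Rightarrow> real \<times> real \<Rightarrow> real" where
  "cutoff n x = flat 1 (- real n * snd x - 1)"

lemma Ck_cutoff: "Ck k (cutoff n)"
  using Ck_compose_affine[OF bounded_linear_const_mult[OF bounded_linear_snd, of "- real n"] Ck_flat[of k 1], of "-1"]
  by (simp add: cutoff_def[abs_def])

lemma cutoff_derivative:
  "(cutoff n has_derivative (\<lambda>v. - real n * snd v * flat [:0,0,1:] (- real n * snd x - 1))) (at x)"
proof -
  have 1: "((\<lambda>x. - real n * snd x - 1) has_derivative (\<lambda>v. - real n * snd v)) (at x)"
    by (auto intro!: derivative_eq_intros)
  have "(flat 1 has_derivative (\<lambda>h. flat [:0,0,1:] (- real n * snd x - 1) * h)) (at (- real n * snd x - 1))"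
    using flat_has_derivative[of 1 "- real n * snd x - 1"] by (simp add: has_field_derivative_def)
  from has_derivative_compose[OF 1 this] show ?thesis
    by (simp add: cutoff_def[abs_def] mult.commute)
qed

text \<open>
  \<open>flat [:0,0,1:]\<close> is the derivative of \<open>flat 1\<close>. At a distance \<open>d\<close> below the line \<open>y = 0\<close> the normal
  derivative of the cut-off times \<open>d\<close> is, up to the sign, the function \<open>s * flat [:0,0,1:] (s - 1)\<close> of
  \<open>s = n d\<close>; the next lemmas show that it is bounded and tends to \<open>0\<close> as \<open>s\<close> tends to infinity.
\<close>
lemma flat_square_eq:
  assumes "s > 1"
  shows "s * flat [:0,0,1:] (s - 1) = (inverse (s - 1) + (inverse (s - 1))\<^sup>2) * exp (- inverse (s - 1))"
proof -
  define r where "r = inverse (s - 1)"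
  have "s = 1 + 1 / r" "r > 0" using assms by (auto simp: r_def inverse_eq_divide)
  then have "s * (r * r) = r + r\<^sup>2" by (simp add: field_simps power2_eq_square)
  moreover have "flat [:0,0,1:] (s - 1) = r * r * exp (- r)"
    using assms by (simp add: flat_def r_def inverse_eq_divide)
  ultimately show ?thesis unfolding r_def[symmetric] by (simp add: mult.assoc[symmetric])
qed

lemma flat_square_bounds: "0 \<le> flat [:0,0,1:] t" "s \<ge> 0 \<Longrightarrow> s * flat [:0,0,1:] (s - 1) \<le> 2"
proof -
  show "0 \<le> flat [:0,0,1:] t" by (simp add: flat_def)
  show "s * flat [:0,0,1:] (s - 1) \<le> 2" if "s \<ge> 0"
  proof (cases "s \<le> 1")
    case False
    define r where "r = inverse (s - 1)"
    have r: "r > 0" using False by (auto simp: r_def)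
    have "s * flat [:0,0,1:] (s - 1) = (r + r\<^sup>2) * exp (- r)"
      using False flat_square_eq[of s] by (simp add: r_def)
    also have "\<dots> \<le> 2"
      using exp_lower_Taylor_quadratic[of r] r by (simp add: exp_minus field_simps)
    finally show ?thesis .
  qed (simp add: flat_def)
qed

lemma flat_square_tendsto: "((\<lambda>s. s * flat [:0,0,1:] (s - 1)) \<longlongrightarrow> 0) at_top"
proof -
  have r: "((\<lambda>s::real. inverse (s - 1)) \<longlongrightarrow> 0) at_top"
    by (intro tendsto_inverse_0_at_top filterlim_tendsto_add_at_top[OF tendsto_const[of "-1"] filterlim_ident, simplified])
  have "((\<lambda>s::real. (inverse (s - 1) + (inverse (s - 1))\<^sup>2) * exp (- inverse (s - 1))) \<longlongrightarrow> (0 + 0\<^sup>2) * exp (- 0)) at_top"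
    by (intro tendsto_intros r)
  then show ?thesis
    unfolding minus_zero exp_zero power2_eq_square mult_zero_right add_0 mult_1_right
    by (rule Lim_transform_eventually)
      (use eventually_gt_at_top[of 1] in eventually_elim, simp add: flat_square_eq power2_eq_square)
qed

section \<open>Weak differentiability of the even reflection\<close>

text \<open>The rectangle \<open>\<Omega>\<^sub>0\<close> together with its mirror image and the open segment between them.\<close>
definition double_box :: "real \<Rightarrow> real \<Rightarrow> (real \<times> real) set" where
  "double_box a b = {0<..<a} \<times> {-b<..<b}"

lemma open_Omega0: "open (Omega0 a b)"
  unfolding Omega0_def by (intro open_Times) auto

lemma open_double_box: "open (double_box a b)"
  unfolding double_box_def by (intro open_Times) auto

lemma finite_measure_Omega0: "finite_measure (lebesgue_on (Omega0 a b))"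
proof (rule finite_measure_lebesgue_on)
  have "bounded (Omega0 a b)" unfolding Omega0_def by (intro bounded_Times) auto
  then show "Omega0 a b \<in> lmeasurable" using open_Omega0 lmeasurable_open by blast
qed

lemma cutoff_mult_test_functions:
  assumes \<psi>: "\<psi> \<in> test_functions (double_box a b)" and n: "n > 0"
  shows "(\<lambda>x. cutoff n x * (\<psi> x + s * \<psi> (mirror x))) \<in> test_functions (Omega0 a b)"
proof -
  let ?f = "\<lambda>x. cutoff n x * (\<psi> x + s * \<psi> (mirror x))"
  define K where "K = closure {x. \<psi> x \<noteq> 0}"
  have K: "compact K" "K \<subseteq> double_box a b" using test_functionsD(5,6)[OF \<psi>] by (auto simp: K_def)
  have K0: "\<psi> x = 0" if "x \<notin> K" for x using vanishing_off_support[of x \<psi>] that by (auto simp: K_def)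
  define K' where "K' = (K \<union> mirror ` K) \<inter> {x. snd x \<le> - 1 / real n}"
  have "compact (mirror ` K)"
    using K(1) bounded_linear_mirror by (intro compact_continuous_image linear_continuous_on)
  moreover have "closed {x::real\<times>real. snd x \<le> - 1 / real n}"
    by (intro closed_Collect_le continuous_intros)
  ultimately have K': "compact K'" unfolding K'_def using K(1) by (intro compact_Int_closed compact_Un)
  have sub: "{x. ?f x \<noteq> 0} \<subseteq> K'"
  proof
    fix x assume "x \<in> {x. ?f x \<noteq> 0}"
    then have 1: "cutoff n x \<noteq> 0" "\<psi> x \<noteq> 0 \<or> \<psi> (mirror x) \<noteq> 0" by auto
    from 1(1) have "\<not> - real n * snd x - 1 \<le> 0" by (auto simp: cutoff_def flat_def)
    then have "snd x \<le> - 1 / real n" using n by (simp add: field_simps)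
    moreover have "x \<in> K \<union> mirror ` K"
      using 1(2) K0[of x] K0[of "mirror x"] by (metis UnI1 UnI2 image_eqI mirror_mirror)
    ultimately show "x \<in> K'" by (simp add: K'_def)
  qed
  then have cl: "closure {x. ?f x \<noteq> 0} \<subseteq> K'"
    using K' by (intro closure_minimal compact_imp_closed)
  have "K' \<subseteq> Omega0 a b"
  proof
    fix x assume x: "x \<in> K'"
    then have "snd x < 0" using n by (auto simp: K'_def intro: le_less_trans)
    moreover have "x \<in> double_box a b"
      using x K(2) by (auto simp: K'_def double_box_def mirror_def)
    ultimately show "x \<in> Omega0 a b" by (auto simp: double_box_def Omega0_def)
  qed
  with cl have "closure {x. ?f x \<noteq> 0} \<subseteq> Omega0 a b" by blast
  moreover have "compact (closure {x. ?f x \<noteq> 0})"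
    using compact_closure bounded_subset[OF compact_imp_bounded[OF K'] sub] by blast
  moreover have "Ck k ?f" for k
    using Ck_compose_affine[OF bounded_linear_mirror test_functionsD(1)[OF \<psi>], of k 0]
    by (intro Ck_mult Ck_add Ck_const Ck_cutoff test_functionsD(1)[OF \<psi>]) auto
  ultimately show ?thesis by (auto simp: test_functions_def)
qed

lemma odd_part_bound:
  assumes \<psi>: "\<psi> \<in> test_functions \<Omega>" and M: "\<And>x. \<bar>frechet_derivative \<psi> (at x) (0, 1)\<bar> \<le> M"
  shows "\<bar>\<psi> x - \<psi> (mirror x)\<bar> \<le> 2 * M * \<bar>snd x\<bar>"
proof -
  define h where "h t = \<psi> (fst x, t)" for t
  have "(h has_real_derivative frechet_derivative \<psi> (at (fst x, t)) (0, 1)) (at t)" for t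
  proof -
    have 1: "((\<lambda>t. (fst x, t)) has_derivative (\<lambda>v. (0, v))) (at t)"
      by (intro has_derivative_Pair has_derivative_const has_derivative_ident)
    have 2: "(\<psi> has_derivative frechet_derivative \<psi> (at (fst x, t))) (at (fst x, t))"
      using test_functionsD(2)[OF \<psi>] unfolding frechet_derivative_works .
    have "frechet_derivative \<psi> (at (fst x, t)) (0, v) = frechet_derivative \<psi> (at (fst x, t)) (0, 1) * v" for v
      using linear_scale[OF linear_frechet_derivative[OF test_functionsD(2)[OF \<psi>]], of "(fst x, t)" v "(0, 1)"]
      by (simp add: mult.commute)
    then have 3: "(\<lambda>v. frechet_derivative \<psi> (at (fst x, t)) (0, v)) = (*) (frechet_derivative \<psi> (at (fst x, t)) (0, 1))"
      by (rule ext)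
    from has_derivative_compose[OF 1 2] show ?thesis
      unfolding 3 has_field_derivative_def h_def .
  qed
  then have "norm (h (snd x) - h (- snd x)) \<le> M * norm (snd x - (- snd x))"
    using M by (intro field_differentiable_bound[of UNIV h "\<lambda>t. frechet_derivative \<psi> (at (fst x, t)) (0, 1)"]) auto
  then show ?thesis by (simp add: h_def mirror_def abs_mult)
qed

text \<open>
  For a direction \<open>i\<close> that \<open>mirror\<close> multiplies by \<open>s\<close>, the part of \<open>\<psi>\<close> with parity \<open>s\<close> times the
  derivative of the cut-off is bounded and tends to \<open>0\<close>: for the tangential direction the derivative is
  \<open>0\<close>, and for the normal one the odd part of \<open>\<psi>\<close> compensates its growth.
\<close>
lemma cutoff_error_term:
  assumes \<psi>: "\<psi> \<in> test_functions \<Omega>" and i: "mirror i = s *\<^sub>R i" "i \<in> Basis"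
  defines "e \<equiv> \<lambda>n x. (\<psi> x + s * \<psi> (mirror x)) * frechet_derivative (cutoff n) (at x) i"
  obtains C where "\<And>n x. snd x < 0 \<Longrightarrow> \<bar>e n x\<bar> \<le> C" "\<And>x. snd x < 0 \<Longrightarrow> (\<lambda>n. e n x) \<longlonglongrightarrow> 0"
proof -
  have D: "frechet_derivative (cutoff n) (at x) v = - real n * snd v * flat [:0,0,1:] (- real n * snd x - 1)" for n x v
    by (rule fun_cong[OF frechet_derivative_at[OF cutoff_derivative, symmetric]])
  consider "i = (1, 0)" | "i = (0, 1)" using i(2) unfolding Basis_plane by blast
  then show thesis
  proof cases
    case 1
    then show thesis using that[of 0] by (simp add: e_def D)
  next
    case 2
    then have s: "s = -1" using i(1) by (simp add: mirror_def)
    obtain M where M: "M \<ge> 0" "\<And>x. \<bar>frechet_derivative \<psi> (at x) (0, 1)\<bar> \<le> M"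
      using test_function_bounds[OF \<psi>] by metis
    define B where "B t = t * flat [:0,0,1:] (t - 1)" for t
    have e: "\<bar>e n x\<bar> \<le> 2 * M * B (real n * (- snd x))" if "snd x < 0" for n x
    proof -
      have "\<bar>e n x\<bar> = \<bar>\<psi> x - \<psi> (mirror x)\<bar> * (real n * flat [:0,0,1:] (- real n * snd x - 1))"
        by (simp add: e_def D s 2 abs_mult flat_square_bounds)
      also have "\<dots> \<le> 2 * M * \<bar>snd x\<bar> * (real n * flat [:0,0,1:] (- real n * snd x - 1))"
        using odd_part_bound[OF \<psi> M(2)] by (intro mult_right_mono) (auto simp: flat_square_bounds)
      also have "\<dots> = 2 * M * B (real n * (- snd x))"
        using that by (simp add: B_def)
      finally show ?thesis .
    qed
    show thesis
    proof (rule that[of "4 * M"])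
      fix n and x :: "real \<times> real" assume x: "snd x < 0"
      have "B (real n * (- snd x)) \<le> 2" unfolding B_def
        using x by (intro flat_square_bounds) (simp add: mult_nonneg_nonpos)
      then have "2 * M * B (real n * (- snd x)) \<le> 2 * M * 2"
        using M by (intro mult_left_mono) auto
      with e[OF x, of n] show "\<bar>e n x\<bar> \<le> 4 * M" by linarith
    next
      fix x :: "real \<times> real" assume x: "snd x < 0"
      have "filterlim (\<lambda>n. real n * (- snd x)) at_top sequentially"
        unfolding mult.commute[of _ "- snd x"]
        using x by (intro filterlim_tendsto_pos_mult_at_top[OF tendsto_const _ filterlim_real_sequentially]) simp
      then have "(\<lambda>n. B (real n * (- snd x))) \<longlonglongrightarrow> 0"
        unfolding B_def by (rule filterlim_compose[OF flat_square_tendsto])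
      then have "(\<lambda>n. 2 * M * B (real n * (- snd x))) \<longlonglongrightarrow> 0"
        by (rule tendsto_mult_right_zero)
      then show "(\<lambda>n. e n x) \<longlonglongrightarrow> 0"
        by (rule Lim_null_comparison[rotated]) (use e[OF x] in auto)
    qed
  qed
qed

lemma cutoff_tendsto: "snd x < 0 \<Longrightarrow> (\<lambda>n. cutoff n x) \<longlonglongrightarrow> 1"
proof -
  assume x: "snd x < 0"
  have *: "filterlim (\<lambda>n. - 1 + (- snd x) * real n) at_top sequentially"
    using x by (intro filterlim_tendsto_add_at_top[OF tendsto_const] filterlim_tendsto_pos_mult_at_top[OF tendsto_const _ filterlim_real_sequentially]) simp
  have "cutoff n x = flat 1 (- 1 + (- snd x) * real n)" for n
    unfolding cutoff_def by (rule arg_cong[where f = "flat 1"]) simp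
  with filterlim_compose[OF flat_1_tendsto *] show ?thesis by simp
qed

lemma symmetrized_derivative:
  assumes \<psi>: "\<And>x. \<psi> differentiable at x" and i: "mirror i = s *\<^sub>R i"
  shows "frechet_derivative (\<lambda>x. \<psi> x + s * \<psi> (mirror x)) (at x) i =
    frechet_derivative \<psi> (at x) i + s * (s * frechet_derivative \<psi> (at (mirror x)) i)"
proof -
  have 1: "(\<psi> has_derivative frechet_derivative \<psi> (at x)) (at x)" for x
    using \<psi> unfolding frechet_derivative_works .
  have "((\<lambda>x. \<psi> x + s * \<psi> (mirror x)) has_derivative
      (\<lambda>v. frechet_derivative \<psi> (at x) v + s * frechet_derivative \<psi> (at (mirror x)) (mirror v))) (at x)"
    by (intro has_derivative_add 1 has_derivative_mult_right
        has_derivative_compose[OF bounded_linear_imp_has_derivative[OF bounded_linear_mirror]])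
  from fun_cong[OF frechet_derivative_at[OF this, symmetric], of i]
  show ?thesis
    using linear_scale[OF linear_frechet_derivative[OF \<psi>]] by (simp add: i)
qed

text \<open>
  The defining identity of the weak gradient on \<open>\<Omega>\<^sub>0\<close> holds for the part of \<open>\<psi>\<close> with the parity of the
  direction \<open>i\<close>, although that function need not vanish near the upper side of \<open>\<Omega>\<^sub>0\<close>.
\<close>
lemma weak_gradient_symmetrized_test:
  fixes \<phi> :: "real \<times> real \<Rightarrow> real"
  assumes \<phi>: "\<phi> \<in> L2 (Omega0 a b)" and g: "g \<in> L2 (Omega0 a b)"
    and w: "has_weak_gradient (Omega0 a b) \<phi> g"
    and \<psi>: "\<psi> \<in> test_functions (double_box a b)" and i: "mirror i = s *\<^sub>R i" "i \<in> Basis"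
  shows "(\<integral>x. \<phi> x * frechet_derivative (\<lambda>x. \<psi> x + s * \<psi> (mirror x)) (at x) i \<partial>lebesgue_on (Omega0 a b)) =
    - (\<integral>x. (g x \<bullet> i) * (\<psi> x + s * \<psi> (mirror x)) \<partial>lebesgue_on (Omega0 a b))"
proof -
  let ?M = "lebesgue_on (Omega0 a b)"
  define \<theta> where "\<theta> x = \<psi> x + s * \<psi> (mirror x)" for x
  define e where "e n x = (\<psi> x + s * \<psi> (mirror x)) * frechet_derivative (cutoff n) (at x) i" for n x
  obtain C where C: "\<And>n x. snd x < 0 \<Longrightarrow> \<bar>e n x\<bar> \<le> C" "\<And>x. snd x < 0 \<Longrightarrow> (\<lambda>n. e n x) \<longlonglongrightarrow> 0"
    using cutoff_error_term[OF \<psi> i] unfolding e_def by metis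
  have neg: "snd x < 0" if "x \<in> Omega0 a b" for x using that by (auto simp: Omega0_def)
  obtain M where M: "M \<ge> 0" "\<And>x. \<bar>\<psi> x\<bar> \<le> M" "\<And>x. \<bar>frechet_derivative \<psi> (at x) i\<bar> \<le> M"
    using test_function_bounds[OF \<psi>] by metis
  have Ck\<theta>: "Ck k \<theta>" for k
    using Ck_compose_affine[OF bounded_linear_mirror test_functionsD(1)[OF \<psi>], of k 0]
    unfolding \<theta>_def by (intro Ck_mult Ck_add Ck_const test_functionsD(1)[OF \<psi>]) auto
  have \<theta>d: "\<theta> differentiable at x" for x using Ck\<theta> by (rule Ck_1D)
  have D\<theta>: "frechet_derivative \<theta> (at x) i = frechet_derivative \<psi> (at x) i + s * (s * frechet_derivative \<psi> (at (mirror x)) i)" for x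
    unfolding \<theta>_def using test_functionsD(2)[OF \<psi>] i(1) by (rule symmetrized_derivative)
  have s: "\<bar>s\<bar> = 1"
  proof -
    have "norm (mirror i) = norm (s *\<^sub>R i)" using i(1) by simp
    then show ?thesis using i(2) by simp
  qed
  have \<theta>b: "\<bar>\<theta> x\<bar> \<le> 2 * M" for x
    using M(2)[of x] M(2)[of "mirror x"] s abs_triangle_ineq[of "\<psi> x" "s * \<psi> (mirror x)"] by (simp add: \<theta>_def abs_mult)
  have D\<theta>b: "\<bar>frechet_derivative \<theta> (at x) i\<bar> \<le> 2 * M" for x
    using M(3)[of x] M(3)[of "mirror x"] s
     abs_triangle_ineq[of "frechet_derivative \<psi> (at x) i" "s * (s * frechet_derivative \<psi> (at (mirror x)) i)"]
    by (simp add: D\<theta> abs_mult)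
  have cut: "0 \<le> cutoff n x" "cutoff n x \<le> 1" for n x by (auto simp: cutoff_def flat_1_bounds)
  have c1: "cutoff n differentiable at x" for n x using cutoff_derivative by (rule differentiableI)
  have prod: "frechet_derivative (\<lambda>x. cutoff n x * \<theta> x) (at x) i = cutoff n x * frechet_derivative \<theta> (at x) i + e n x" for n x
  proof -
    have "((\<lambda>x. cutoff n x * \<theta> x) has_derivative (\<lambda>v. cutoff n x * frechet_derivative \<theta> (at x) v
        + frechet_derivative (cutoff n) (at x) v * \<theta> x)) (at x)"
      using c1 \<theta>d unfolding frechet_derivative_works by (intro has_derivative_mult)
    from fun_cong[OF frechet_derivative_at[OF this, symmetric], of i]
    show ?thesis by (simp add: e_def \<theta>_def mult.commute)
  qed
  have m\<theta>: "\<theta> \<in> borel_measurable ?M" "cutoff n \<in> borel_measurable ?M"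
    "(\<lambda>x. frechet_derivative \<theta> (at x) i) \<in> borel_measurable ?M"
    "(\<lambda>x. frechet_derivative (cutoff n) (at x) i) \<in> borel_measurable ?M" for n
    by (rule continuous_borel_measurable_lebesgue_on,
        rule Ck\<theta>[of 0, simplified] Ck_1D(2)[OF Ck\<theta>] Ck_cutoff[of 0, simplified] Ck_1D(2)[OF Ck_cutoff])+
  have me: "e n \<in> borel_measurable ?M" for n
    using borel_measurable_times[OF m\<theta>(1,4)] unfolding e_def \<theta>_def .
  have L1: "integrable ?M v" if "v \<in> L2 (Omega0 a b)" for v :: "real \<times> real \<Rightarrow> real"
    using finite_measure.square_integrable_imp_integrable[OF finite_measure_Omega0 L2D(1)[OF that]] L2D(2)[OF that]
    by simp
  note i\<phi> = L1[OF \<phi>] and ig = L1[OF L2_inner_const[OF g]]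
  \<comment> \<open>Test with the product with the cut-off and let \<open>n\<close> tend to infinity on both sides.\<close>
  have lim1: "(\<lambda>n. \<integral>x. \<phi> x * frechet_derivative (\<lambda>x. cutoff n x * \<theta> x) (at x) i \<partial>?M) \<longlonglongrightarrow>
     (\<integral>x. \<phi> x * frechet_derivative \<theta> (at x) i \<partial>?M)"
  proof (rule integral_dominated_convergence)
    show "integrable ?M (\<lambda>x. \<bar>\<phi> x\<bar> * (2 * M + C))" using i\<phi> by simp
    show "AE x in ?M. (\<lambda>n. \<phi> x * frechet_derivative (\<lambda>x. cutoff n x * \<theta> x) (at x) i) \<longlonglongrightarrow>
      \<phi> x * frechet_derivative \<theta> (at x) i"
      unfolding prod by (intro AE_I2) (auto intro!: tendsto_eq_intros cutoff_tendsto C(2) dest: neg)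
    show "AE x in ?M. norm (\<phi> x * frechet_derivative (\<lambda>x. cutoff n x * \<theta> x) (at x) i) \<le> \<bar>\<phi> x\<bar> * (2 * M + C)" for n
    proof (intro AE_I2)
      fix x assume "x \<in> space ?M"
      then have x: "snd x < 0" using neg by simp
      have "\<bar>cutoff n x * frechet_derivative \<theta> (at x) i\<bar> \<le> 1 * (2 * M)"
        unfolding abs_mult using cut D\<theta>b by (intro mult_mono) auto
      then have "\<bar>cutoff n x * frechet_derivative \<theta> (at x) i + e n x\<bar> \<le> 2 * M + C"
        using C(1)[OF x, of n] by linarith
      then show "norm (\<phi> x * frechet_derivative (\<lambda>x. cutoff n x * \<theta> x) (at x) i) \<le> \<bar>\<phi> x\<bar> * (2 * M + C)"
        unfolding prod real_norm_def abs_mult by (intro mult_left_mono) auto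
    qed
  qed (use i\<phi> m\<theta> me in \<open>auto simp: prod\<close>)
  have lim2: "(\<lambda>n. - (\<integral>x. (g x \<bullet> i) * (cutoff n x * \<theta> x) \<partial>?M)) \<longlonglongrightarrow> - (\<integral>x. (g x \<bullet> i) * \<theta> x \<partial>?M)"
  proof (intro tendsto_minus integral_dominated_convergence)
    show "integrable ?M (\<lambda>x. \<bar>g x \<bullet> i\<bar> * (2 * M))" using ig[of i] by simp
    have "(\<lambda>n. (g x \<bullet> i) * (cutoff n x * \<theta> x)) \<longlonglongrightarrow> (g x \<bullet> i) * (1 * \<theta> x)" if "x \<in> Omega0 a b" for x
      by (intro tendsto_intros cutoff_tendsto neg that)
    then show "AE x in ?M. (\<lambda>n. (g x \<bullet> i) * (cutoff n x * \<theta> x)) \<longlonglongrightarrow> (g x \<bullet> i) * \<theta> x"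
      by (intro AE_I2) simp
    have "\<bar>cutoff n x\<bar> * \<bar>\<theta> x\<bar> \<le> 1 * (2 * M)" for n x
      using cut \<theta>b by (intro mult_mono) auto
    then show "AE x in ?M. norm ((g x \<bullet> i) * (cutoff n x * \<theta> x)) \<le> \<bar>g x \<bullet> i\<bar> * (2 * M)" for n
      by (intro AE_I2) (auto simp: abs_mult intro!: mult_left_mono)
  qed (use ig m\<theta> in auto)
  have ev: "\<forall>\<^sub>F n in sequentially. (\<integral>x. \<phi> x * frechet_derivative (\<lambda>x. cutoff n x * \<theta> x) (at x) i \<partial>?M) =
     - (\<integral>x. (g x \<bullet> i) * (cutoff n x * \<theta> x) \<partial>?M)"
    using eventually_gt_at_top[of 0]
  proof eventually_elim
    case (elim n)
    from w[unfolded has_weak_gradient_def, THEN bspec, OF cutoff_mult_test_functions[OF \<psi> elim], THEN bspec, OF i(2)]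
    show ?case unfolding \<theta>_def .
  qed
  from LIMSEQ_unique[OF Lim_transform_eventually[OF lim1 ev] lim2]
  show ?thesis unfolding \<theta>_def .
qed

lemma has_weak_gradient_even_reflection:
  fixes \<phi> :: "real \<times> real \<Rightarrow> real"
  assumes \<phi>: "\<phi> \<in> L2 (Omega0 a b)" and g: "g \<in> L2 (Omega0 a b)"
    and w: "has_weak_gradient (Omega0 a b) \<phi> g"
  shows "has_weak_gradient (double_box a b)
     (even_reflection (Omega0 a b) \<phi>) (reflected_field (Omega0 a b) g)"
  unfolding has_weak_gradient_def
proof (intro ballI)
  fix \<psi> :: "real \<times> real \<Rightarrow> real" and i :: "real \<times> real"
  assume \<psi>: "\<psi> \<in> test_functions (double_box a b)" and i: "i \<in> Basis"
  obtain s where s: "mirror i = s *\<^sub>R i" "s * s = 1"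
  proof -
    from i consider "i = (1, 0)" | "i = (0, 1)" unfolding Basis_plane by blast
    then show thesis by cases (use that[of 1] that[of "-1"] in \<open>auto simp: mirror_def\<close>)
  qed
  let ?\<Omega> = "Omega0 a b"
  have \<Omega>s: "?\<Omega> \<in> sets lebesgue" "double_box a b \<in> sets lebesgue"
    using open_Omega0 open_double_box by auto
  define P where "P x = indicator ?\<Omega> x *\<^sub>R \<phi> x" for x
  define Q where "Q x = (indicator ?\<Omega> x *\<^sub>R g x) \<bullet> i" for x
  define D where "D x = frechet_derivative \<psi> (at x) i" for x
  have P: "P \<in> L2 UNIV" unfolding P_def by (rule L2_indicator[OF \<phi> \<Omega>s(1)])
  have Q: "Q \<in> L2 UNIV" unfolding Q_def by (rule L2_inner_const[OF L2_indicator[OF g \<Omega>s(1)]])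
  have \<psi>L: "\<psi> \<in> L2 UNIV" "D \<in> L2 UNIV"
    using test_function_L2[OF \<psi>, of UNIV] unfolding D_def by auto
  have v: "\<psi> x = 0" "D x = 0" if "x \<notin> double_box a b" for x
    using vanishing_off_support[of x \<psi>] test_functionsD(6)[OF \<psi>] that unfolding D_def by blast+
  have mirror_adj: "mirror v \<bullet> i = s * (v \<bullet> i)" for v
  proof -
    have "mirror v \<bullet> i = v \<bullet> mirror i" by (simp add: mirror_def inner_prod_def)
    then show ?thesis using s by simp
  qed
  \<comment> \<open>Transfer of the reflection from one factor to the other by a change of variables.\<close>
  have unfold_mirror: "(\<integral>x. (A x + c * A (mirror x)) * B x \<partial>lebesgue) =
      (\<integral>x. A x * (B x + c * B (mirror x)) \<partial>lebesgue)"
    if A: "A \<in> L2 UNIV" and B: "B \<in> L2 UNIV" for c and A B :: "real \<times> real \<Rightarrow> real"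
  proof -
    note Ar = L2_UNIV_mirror[OF A] and Br = L2_UNIV_mirror[OF B]
    have int: "integrable lebesgue (\<lambda>x. A x * B x)" "integrable lebesgue (\<lambda>x. A (mirror x) * B x)"
      "integrable lebesgue (\<lambda>x. A x * B (mirror x))"
      using L2_inner_integrable[OF A B] L2_inner_integrable[OF Ar B] L2_inner_integrable[OF A Br]
      by (auto simp: lebesgue_on_UNIV_eq)
    have "(\<integral>x. A (mirror x) * B x \<partial>lebesgue) = (\<integral>x. A x * B (mirror x) \<partial>lebesgue)"
      using integral_mirror[of "\<lambda>x. A x * B (mirror x)"] int(3) by auto
    then show ?thesis
      using int by (simp add: distrib_left distrib_right mult.assoc mult.left_commute[of _ c])
  qed
  have "(\<integral>x. even_reflection ?\<Omega> \<phi> x * D x \<partial>lebesgue_on (double_box a b)) =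
     (\<integral>x. even_reflection ?\<Omega> \<phi> x * D x \<partial>lebesgue)"
    using v \<Omega>s integral_lebesgue_on_subset[of "double_box a b" UNIV "\<lambda>x. even_reflection ?\<Omega> \<phi> x * D x"]
    by (simp add: lebesgue_on_UNIV_eq)
  also have "\<dots> = (\<integral>x. (P x + 1 * P (mirror x)) * D x \<partial>lebesgue)"
    by (simp add: even_reflection_def P_def)
  also have "\<dots> = (\<integral>x. P x * (D x + 1 * D (mirror x)) \<partial>lebesgue)"
    by (rule unfold_mirror[OF P \<psi>L(2)])
  also have "\<dots> = (\<integral>x. \<phi> x * (D x + D (mirror x)) \<partial>lebesgue_on ?\<Omega>)"
    using \<Omega>s by (simp add: integral_restrict_space P_def mult.assoc)
  also have "\<dots> = (\<integral>x. \<phi> x * frechet_derivative (\<lambda>x. \<psi> x + s * \<psi> (mirror x)) (at x) i \<partial>lebesgue_on ?\<Omega>)"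
    using s(2) by (simp add: symmetrized_derivative[OF test_functionsD(2)[OF \<psi>] s(1)] D_def mult.assoc[symmetric])
  also have "\<dots> = - (\<integral>x. (g x \<bullet> i) * (\<psi> x + s * \<psi> (mirror x)) \<partial>lebesgue_on ?\<Omega>)"
    by (rule weak_gradient_symmetrized_test[OF \<phi> g w \<psi> s(1) i])
  also have "(\<integral>x. (g x \<bullet> i) * (\<psi> x + s * \<psi> (mirror x)) \<partial>lebesgue_on ?\<Omega>) =
     (\<integral>x. Q x * (\<psi> x + s * \<psi> (mirror x)) \<partial>lebesgue)"
    using \<Omega>s by (simp add: integral_restrict_space Q_def mult.assoc)
  also have "\<dots> = (\<integral>x. (Q x + s * Q (mirror x)) * \<psi> x \<partial>lebesgue)"
    by (rule unfold_mirror[OF Q \<psi>L(1), symmetric])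
  also have "\<dots> = (\<integral>x. (reflected_field ?\<Omega> g x \<bullet> i) * \<psi> x \<partial>lebesgue)"
    unfolding reflected_field_def inner_add_left mirror_adj Q_def by simp
  also have "\<dots> = (\<integral>x. (reflected_field ?\<Omega> g x \<bullet> i) * \<psi> x \<partial>lebesgue_on (double_box a b))"
    using v \<Omega>s integral_lebesgue_on_subset[of "double_box a b" UNIV "\<lambda>x. (reflected_field ?\<Omega> g x \<bullet> i) * \<psi> x"]
    by (simp add: lebesgue_on_UNIV_eq)
  finally show "(\<integral>x. even_reflection ?\<Omega> \<phi> x * frechet_derivative \<psi> (at x) i \<partial>lebesgue_on (double_box a b)) =
    - (\<integral>x. (reflected_field ?\<Omega> g x \<bullet> i) * \<psi> x \<partial>lebesgue_on (double_box a b))"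
    unfolding D_def .
qed

section \<open>Geometry of the perturbed domains\<close>

text \<open>
  The first smallness condition says that a channel is no wider than a period, so that all channels lie
  over \<open>(0, a)\<close>, the last one included; the second one keeps \<open>\<Omega>\<^sub>\<epsilon>\<close> inside the reflected rectangle.
\<close>
lemma Omega_eps_geometry:
  assumes pos: "L > 0" "V > 0" "\<alpha> > 0" "\<epsilon> > 0" "b > 0" and small: "\<alpha> * \<epsilon>\<^sup>2 \<le> 1" "(L + V) * \<epsilon> \<le> b"
  shows "open (Omega_eps a b L V \<alpha> \<epsilon>)" "Omega0 a b \<subseteq> Omega_eps a b L V \<alpha> \<epsilon>"
    "Omega_eps a b L V \<alpha> \<epsilon> \<subseteq> double_box a b"
    "Omega_eps a b L V \<alpha> \<epsilon> - Omega0 a b \<subseteq> {x. 0 \<le> snd x \<and> snd x \<le> (L + V) * \<epsilon>}"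
proof -
  let ?K = "{k::nat. real k \<le> a / \<epsilon> - 1}"
  have Lb: "L * \<epsilon> < (L + V) * \<epsilon>" "0 < L * \<epsilon>" using pos by auto
  have chan: "{real k * \<epsilon> <..< real k * \<epsilon> + \<alpha> * \<epsilon> ^ 3} \<subseteq> {0<..<a}" if "k \<in> ?K" for k
  proof -
    have "\<alpha> * \<epsilon> ^ 3 = (\<alpha> * \<epsilon>\<^sup>2) * \<epsilon>" by (simp add: power2_eq_square power3_eq_cube)
    also have "\<dots> \<le> 1 * \<epsilon>" using small pos by (intro mult_right_mono) auto
    finally have 1: "\<alpha> * \<epsilon> ^ 3 \<le> \<epsilon>" by simp
    have "(real k + 1) * \<epsilon> \<le> a" using that pos by (simp add: field_simps)
    with 1 have "real k * \<epsilon> + \<alpha> * \<epsilon> ^ 3 \<le> a" by (simp add: algebra_simps)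
    moreover have "0 \<le> real k * \<epsilon>" using pos by simp
    ultimately show ?thesis by (auto intro: le_less_trans less_le_trans)
  qed
  show "Omega0 a b \<subseteq> Omega_eps a b L V \<alpha> \<epsilon>" by (auto simp: Omega_eps_def)
  show "Omega_eps a b L V \<alpha> \<epsilon> \<subseteq> double_box a b"
    unfolding Omega_eps_def
  proof (intro Un_least)
    show "Omega0 a b \<subseteq> double_box a b" using pos by (auto simp: Omega0_def double_box_def)
    show "S_eps a L V \<epsilon> \<subseteq> double_box a b"
    proof
      fix x assume "x \<in> S_eps a L V \<epsilon>"
      then have "fst x \<in> {0<..<a}" "L * \<epsilon> < snd x" "snd x < (L + V) * \<epsilon>" by (auto simp: S_eps_def)
      with Lb small(2) pos(5) show "x \<in> double_box a b" by (simp add: double_box_def mem_Times_iff)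
    qed
    show "C_eps a L \<alpha> \<epsilon> \<subseteq> double_box a b"
    proof
      fix x assume "x \<in> C_eps a L \<alpha> \<epsilon>"
      then obtain k where k: "k \<in> ?K" "fst x \<in> {real k * \<epsilon> <..< real k * \<epsilon> + \<alpha> * \<epsilon> ^ 3}" "snd x \<in> {0..L * \<epsilon>}"
        by (auto simp: C_eps_def)
      from chan[OF k(1)] k(2) have "fst x \<in> {0<..<a}" by blast
      moreover have "0 \<le> snd x" "snd x \<le> L * \<epsilon>" using k(3) by auto
      then have "- b < snd x" "snd x < b" using Lb(1) small(2) pos(5) by linarith+
      ultimately show "x \<in> double_box a b" by (simp add: double_box_def mem_Times_iff)
    qed
  qed
  show "Omega_eps a b L V \<alpha> \<epsilon> - Omega0 a b \<subseteq> {x. 0 \<le> snd x \<and> snd x \<le> (L + V) * \<epsilon>}"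
    using Lb by (auto simp: Omega_eps_def S_eps_def C_eps_def)
  \<comment> \<open>Thickening each channel into both neighbours shows that the union is open.\<close>
  define N where "N k = {real k * \<epsilon> <..< real k * \<epsilon> + \<alpha> * \<epsilon> ^ 3} \<times> {-b<..<(L + V) * \<epsilon>}" for k :: nat
  have "Omega_eps a b L V \<alpha> \<epsilon> = Omega0 a b \<union> S_eps a L V \<epsilon> \<union> (\<Union>k\<in>?K. N k)"
  proof
    show "Omega_eps a b L V \<alpha> \<epsilon> \<subseteq> Omega0 a b \<union> S_eps a L V \<epsilon> \<union> (\<Union>k\<in>?K. N k)"
      using Lb pos(5) unfolding Omega_eps_def C_eps_def N_def by fastforce
    have "N k \<subseteq> Omega_eps a b L V \<alpha> \<epsilon>" if k: "k \<in> ?K" for k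
    proof
      fix x assume x: "x \<in> N k"
      then have c: "fst x \<in> {real k * \<epsilon> <..< real k * \<epsilon> + \<alpha> * \<epsilon> ^ 3}" and y: "-b < snd x" "snd x < (L + V) * \<epsilon>"
        by (auto simp: N_def)
      from chan[OF k] c have f: "fst x \<in> {0<..<a}" by blast
      consider "snd x < 0" | "0 \<le> snd x" "snd x \<le> L * \<epsilon>" | "L * \<epsilon> < snd x" by linarith
      then show "x \<in> Omega_eps a b L V \<alpha> \<epsilon>"
      proof cases
        case 1
        with f y have "x \<in> Omega0 a b" by (simp add: Omega0_def mem_Times_iff)
        then show ?thesis by (simp add: Omega_eps_def)
      next
        case 2
        with c k have "x \<in> C_eps a L \<alpha> \<epsilon>" unfolding C_eps_def by (intro UN_I[of k]) (auto simp: mem_Times_iff)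
        then show ?thesis by (simp add: Omega_eps_def)
      next
        case 3
        with f y have "x \<in> S_eps a L V \<epsilon>" by (simp add: S_eps_def mem_Times_iff)
        then show ?thesis by (simp add: Omega_eps_def)
      qed
    qed
    then show "Omega0 a b \<union> S_eps a L V \<epsilon> \<union> (\<Union>k\<in>?K. N k) \<subseteq> Omega_eps a b L V \<alpha> \<epsilon>"
      by (auto simp: Omega_eps_def)
  qed
  moreover have "open (S_eps a L V \<epsilon>)" "\<And>k. open (N k)"
    unfolding S_eps_def N_def by (intro open_Times open_greaterThanLessThan)+
  ultimately show "open (Omega_eps a b L V \<alpha> \<epsilon>)"
    using open_Omega0 by (auto intro!: open_Un)
qed

section \<open>Vanishing of the remainder\<close>

lemma integral_lebesgue_on_split:
  fixes h :: "'a::euclidean_space \<Rightarrow> 'b::{banach, second_countable_topology}"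
  assumes "A \<subseteq> B" "A \<in> sets lebesgue" "B \<in> sets lebesgue" "integrable (lebesgue_on B) h"
  shows "(\<integral>x. h x \<partial>lebesgue_on B) = (\<integral>x. h x \<partial>lebesgue_on A) + (\<integral>x. h x \<partial>lebesgue_on (B - A))"
proof -
  have "A \<union> (B - A) = B" using assms(1) by blast
  moreover have "set_integrable lebesgue A h" "set_integrable lebesgue (B - A) h"
    using integrable_lebesgue_on_subset[OF assms] integrable_lebesgue_on_subset[of "B - A" B h] assms
    by (auto simp: set_integrable_def integrable_restrict_space)
  ultimately have "(\<integral>x\<in>B. h x \<partial>lebesgue) = (\<integral>x\<in>A. h x \<partial>lebesgue) + (\<integral>x\<in>B-A. h x \<partial>lebesgue)"
    using set_integral_Un[of A "B - A" lebesgue h] by simp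
  then show ?thesis using assms by (simp add: integral_restrict_space set_lebesgue_integral_def)
qed

lemma integral_lebesgue_on_mono_set:
  fixes h :: "'a::euclidean_space \<Rightarrow> real"
  assumes "A \<subseteq> B" "A \<in> sets lebesgue" "B \<in> sets lebesgue" "integrable (lebesgue_on B) h" "\<And>x. h x \<ge> 0"
  shows "(\<integral>x. h x \<partial>lebesgue_on A) \<le> (\<integral>x. h x \<partial>lebesgue_on B)"
  using integral_lebesgue_on_split[OF assms(1-4)] integral_nonneg_AE[of h "lebesgue_on (B - A)"] assms(5) by simp

lemma Cauchy_Schwarz_on_subset:
  fixes u w :: "'a::euclidean_space \<Rightarrow> 'b::euclidean_space"
  assumes "u \<in> L2 \<Omega>" "w \<in> L2 UNIV" "E \<subseteq> \<Omega>" "E \<subseteq> S"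
    and s: "E \<in> sets lebesgue" "\<Omega> \<in> sets lebesgue" "S \<in> sets lebesgue"
  shows "\<bar>\<integral>x. u x \<bullet> w x \<partial>lebesgue_on E\<bar> \<le>
    sqrt (\<integral>x. (norm (u x))\<^sup>2 \<partial>lebesgue_on \<Omega>) * sqrt (\<integral>x. (norm (w x))\<^sup>2 \<partial>lebesgue_on S)"
proof -
  have wS: "w \<in> L2 S" using L2_subset[of S UNIV w] assms by simp
  have "u \<in> L2 E" "w \<in> L2 E"
    using L2_subset[of E \<Omega> u] L2_subset[of E S w] assms wS by auto
  from L2_Cauchy_Schwarz[OF this]
  have "\<bar>\<integral>x. u x \<bullet> w x \<partial>lebesgue_on E\<bar> \<le>
    sqrt (\<integral>x. (norm (u x))\<^sup>2 \<partial>lebesgue_on E) * sqrt (\<integral>x. (norm (w x))\<^sup>2 \<partial>lebesgue_on E)" .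
  also have "\<dots> \<le> sqrt (\<integral>x. (norm (u x))\<^sup>2 \<partial>lebesgue_on \<Omega>) * sqrt (\<integral>x. (norm (w x))\<^sup>2 \<partial>lebesgue_on S)"
    using integral_lebesgue_on_mono_set[OF assms(3) s(1,2) L2D(2)[OF assms(1)]]
      integral_lebesgue_on_mono_set[OF assms(4) s(1,3) L2D(2)[OF wS]]
    by (intro mult_mono) (auto intro!: integral_nonneg_AE)
  finally show ?thesis .
qed

lemma strip_sets_lebesgue: "{x::real \<times> real. 0 \<le> snd x \<and> snd x \<le> d} \<in> sets lebesgue"
proof -
  have "closed {x::real \<times> real. 0 \<le> snd x \<and> snd x \<le> d}"
    by (intro closed_Collect_conj closed_Collect_le continuous_intros)
  then show ?thesis
    by (intro sets_completionI_sets) (simp add: borel_closed)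
qed

lemma integral_thin_strip_tendsto_0:
  fixes F :: "real \<times> real \<Rightarrow> real"
  assumes F: "integrable lebesgue F" and zero: "\<And>x. snd x = 0 \<Longrightarrow> F x = 0" and d: "d \<longlonglongrightarrow> 0"
  shows "(\<lambda>n. \<integral>x. F x \<partial>lebesgue_on {x. 0 \<le> snd x \<and> snd x \<le> d n}) \<longlonglongrightarrow> 0"
proof -
  let ?S = "\<lambda>n. {x::real\<times>real. 0 \<le> snd x \<and> snd x \<le> d n}"
  note S = strip_sets_lebesgue
  have "(\<lambda>n. \<integral>x. indicat_real (?S n) x * F x \<partial>lebesgue) \<longlonglongrightarrow> (\<integral>x. 0 \<partial>(lebesgue :: (real \<times> real) measure))"
  proof (rule integral_dominated_convergence)
    show "integrable lebesgue (\<lambda>x. \<bar>F x\<bar>)" using F by simp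
    show "(\<lambda>x. indicator (?S n) x * F x) \<in> borel_measurable lebesgue" for n
      using F S[of "d n"] by (intro borel_measurable_times borel_measurable_indicator) auto
    show "AE x in lebesgue. norm (indicator (?S n) x * F x) \<le> \<bar>F x\<bar>" for n
      by (intro AE_I2) (simp add: indicator_def)
    show "AE x in lebesgue. (\<lambda>n. indicator (?S n) x * F x) \<longlonglongrightarrow> 0"
    proof (intro AE_I2)
      fix x :: "real \<times> real"
      show "(\<lambda>n. indicator (?S n) x * F x) \<longlonglongrightarrow> 0"
      proof (cases "snd x > 0")
        case True
        from order_tendstoD(2)[OF d True]
        have "\<forall>\<^sub>F n in sequentially. indicator (?S n) x * F x = 0"
          by (rule eventually_mono) (simp add: indicator_def)
        then show ?thesis by (rule tendsto_eventually)
      next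
        case False
        then have "indicator (?S n) x * F x = 0" for n
          using zero[of x] by (auto simp: indicator_def)
        then show ?thesis by (simp only: tendsto_const)
      qed
    qed
  qed simp
  then show ?thesis using S by (simp add: integral_restrict_space)
qed

section \<open>The limit problem\<close>

theorem theorem1p1:
  fixes a b L V \<alpha> \<omega> :: real
    and f u :: "real \<times> real \<Rightarrow> real"
    and eps :: "nat \<Rightarrow> real"
    and U :: "nat \<Rightarrow> real \<times> real \<Rightarrow> real"
  assumes "a > 0" and "b > 0" and "L > 0" and "V > 0" and "\<alpha> > 0" and "\<omega> > 0"
    and "f \<in> L2 UNIV"
    and "AE x in lebesgue. x \<notin> Omega0 a b \<longrightarrow> f x = 0"
    and "\<And>n. eps n > 0"
    and "\<And>n. a / eps n \<in> \<nat>"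
    and "eps \<longlonglongrightarrow> 0"
    and "\<And>n. neumann_helmholtz_solution (Omega_eps a b L V \<alpha> (eps n)) \<omega> f (U n)"
    and "\<exists>C. \<forall>n. H1_norm (Omega_eps a b L V \<alpha> (eps n)) (U n) \<le> C"
    and "u \<in> H1 (Omega0 a b)"
    and "H1_weakly_converges (Omega0 a b) U u"
  shows "neumann_helmholtz_solution (Omega0 a b) \<omega> f u"
proof -
  let ?\<Omega> = "Omega0 a b"
  let ?W = "\<lambda>n. Omega_eps a b L V \<alpha> (eps n)"
  have Os: "?\<Omega> \<in> sets lebesgue" "double_box a b \<in> sets lebesgue"
    using open_Omega0 open_double_box by auto
  obtain C where C: "\<And>n. H1_norm (?W n) (U n) \<le> C" using assms(13) by blast
  have sol: "U n \<in> H1 (?W n)" "\<And>\<phi>. \<phi> \<in> H1 (?W n) \<Longrightarrow>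
     (\<integral>x. weak_grad (?W n) (U n) x \<bullet> weak_grad (?W n) \<phi> x \<partial>lebesgue_on (?W n))
          - \<omega>\<^sup>2 * (\<integral>x. U n x * \<phi> x \<partial>lebesgue_on (?W n)) = (\<integral>x. f x * \<phi> x \<partial>lebesgue_on (?W n))" for n
    using assms(12)[of n] unfolding neumann_helmholtz_solution_def by auto
  have "helmholtz_form ?\<Omega> \<omega> \<phi> u = (\<integral>x. f x * \<phi> x \<partial>lebesgue_on ?\<Omega>)" if \<phi>: "\<phi> \<in> H1 ?\<Omega>" for \<phi>
  proof -
    define g where "g = weak_grad ?\<Omega> \<phi>"
    define \<Phi> where "\<Phi> = even_reflection ?\<Omega> \<phi>"
    define G where "G = reflected_field ?\<Omega> g"
    note \<phi>' = H1_imp_L2[OF \<phi>] weak_grad[OF \<phi>, folded g_def]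
    have L: "\<Phi> \<in> L2 UNIV" "G \<in> L2 UNIV"
      unfolding \<Phi>_def G_def using L2_even_reflection[OF \<phi>'(1) Os(1)] L2_reflected_field[OF \<phi>'(2) Os(1)] by auto
    have wG: "has_weak_gradient (double_box a b) \<Phi> G"
      unfolding \<Phi>_def G_def by (rule has_weak_gradient_even_reflection[OF \<phi>'])
    have low: "\<Phi> x = \<phi> x" "G x = g x" if "x \<in> ?\<Omega>" for x
    proof -
      have "mirror x \<notin> ?\<Omega>" using that by (auto simp: Omega0_def mem_Times_iff)
      with that show "\<Phi> x = \<phi> x" "G x = g x"
        unfolding \<Phi>_def G_def even_reflection_def reflected_field_def by (auto simp: mirror_def zero_prod_def)
    qed
    \<comment> \<open>The strips shrink to the line \<open>y = 0\<close>, where the extensions vanish by definition.\<close>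
    have line: "\<Phi> x = 0" "G x = 0" if "snd x = 0" for x
    proof -
      have "mirror x \<notin> ?\<Omega>" "x \<notin> ?\<Omega>" using that by (auto simp: Omega0_def mem_Times_iff)
      then show "\<Phi> x = 0" "G x = 0"
        unfolding \<Phi>_def G_def even_reflection_def reflected_field_def by (auto simp: mirror_def zero_prod_def)
    qed
    let ?S = "\<lambda>n. {x::real\<times>real. 0 \<le> snd x \<and> snd x \<le> (L + V) * eps n}"
    note Ss = strip_sets_lebesgue
    \<comment> \<open>The bound for the contribution of \<open>\<Omega>\<^sub>\<epsilon> - \<Omega>\<^sub>0\<close>.\<close>
    define R where "R n = C * sqrt (\<integral>x. (norm (G x))\<^sup>2 \<partial>lebesgue_on (?S n))
       + \<omega>\<^sup>2 * (C * sqrt (\<integral>x. (norm (\<Phi> x))\<^sup>2 \<partial>lebesgue_on (?S n)))" for n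
    have d: "(\<lambda>n. (L + V) * eps n) \<longlonglongrightarrow> 0"
      using tendsto_mult_right_zero[OF assms(11)] .
    have "(\<lambda>n. \<integral>x. (norm (G x))\<^sup>2 \<partial>lebesgue_on (?S n)) \<longlonglongrightarrow> 0"
      "(\<lambda>n. \<integral>x. (norm (\<Phi> x))\<^sup>2 \<partial>lebesgue_on (?S n)) \<longlonglongrightarrow> 0"
      using L2D(2)[OF L(1)] L2D(2)[OF L(2)] line unfolding lebesgue_on_UNIV_eq
      by (auto intro!: integral_thin_strip_tendsto_0[OF _ _ d])
    then have "R \<longlonglongrightarrow> C * sqrt 0 + \<omega>\<^sup>2 * (C * sqrt 0)"
      unfolding R_def by (intro tendsto_intros)
    then have R0: "R \<longlonglongrightarrow> 0" by simp
    have small: "\<forall>\<^sub>F n in sequentially. \<alpha> * (eps n)\<^sup>2 \<le> 1 \<and> (L + V) * eps n \<le> b"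
    proof (intro eventually_conj)
      have "(\<lambda>n. \<alpha> * (eps n)\<^sup>2) \<longlonglongrightarrow> \<alpha> * 0\<^sup>2" by (intro tendsto_intros assms(11))
      from order_tendstoD(2)[OF this, of 1] show "\<forall>\<^sub>F n in sequentially. \<alpha> * (eps n)\<^sup>2 \<le> 1"
        by (auto elim!: eventually_mono)
      from order_tendstoD(2)[OF d assms(2)] show "\<forall>\<^sub>F n in sequentially. (L + V) * eps n \<le> b"
        by (auto elim!: eventually_mono)
    qed
    have main: "\<bar>(\<integral>x. f x * \<phi> x \<partial>lebesgue_on ?\<Omega>) - helmholtz_form ?\<Omega> \<omega> \<phi> (U n)\<bar> \<le> R n"
      if n: "\<alpha> * (eps n)\<^sup>2 \<le> 1 \<and> (L + V) * eps n \<le> b" for n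
    proof -
      note geo = Omega_eps_geometry[OF assms(3-5) assms(9) assms(2) n[THEN conjunct1] n[THEN conjunct2], of a]
      define E where "E = ?W n - ?\<Omega>"
      have Ws: "?W n \<in> sets lebesgue" using geo(1) by auto
      have E: "E \<in> sets lebesgue" "E \<subseteq> ?W n" "E \<subseteq> ?S n" using Ws Os geo(4) unfolding E_def by auto
      define w where "w = weak_grad (?W n) (U n)"
      note w = weak_grad[OF sol(1)[of n], folded w_def] and UL = H1_imp_L2[OF sol(1)[of n]]
      have LW: "\<Phi> \<in> L2 (?W n)" "G \<in> L2 (?W n)" "f \<in> L2 (?W n)"
        using L assms(7) Ws L2_subset[OF subset_UNIV, of "?W n"] by auto
      have wW: "has_weak_gradient (?W n) \<Phi> G"
        by (rule has_weak_gradient_subset[OF wG geo(3) Ws Os(2)])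
      have \<Phi>W: "\<Phi> \<in> H1 (?W n)" using H1_I LW wW by blast
      have UO: "U n \<in> H1 ?\<Omega>" using assms(15) by (simp add: H1_weakly_converges_def)
      have wO: "w \<in> L2 ?\<Omega>" by (rule L2_subset[OF geo(2) Os(1) Ws w(1)])
      have "(\<integral>x. w x \<bullet> weak_grad (?W n) \<Phi> x \<partial>lebesgue_on (?W n)) = (\<integral>x. w x \<bullet> G x \<partial>lebesgue_on (?W n))"
        using L2_inner_integrable[OF w(1) weak_grad(1)[OF \<Phi>W]] L2_inner_integrable[OF w(1) LW(2)]
          weak_grad_AE_eq[OF geo(1) \<Phi>W LW(2) wW]
        by (intro integral_cong_AE) auto
      also have "\<dots> = (\<integral>x. w x \<bullet> G x \<partial>lebesgue_on ?\<Omega>) + (\<integral>x. w x \<bullet> G x \<partial>lebesgue_on E)"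
        unfolding E_def by (rule integral_lebesgue_on_split[OF geo(2) Os(1) Ws L2_inner_integrable[OF w(1) LW(2)]])
      also have "(\<integral>x. w x \<bullet> G x \<partial>lebesgue_on ?\<Omega>) = (\<integral>x. w x \<bullet> g x \<partial>lebesgue_on ?\<Omega>)"
        using low by (intro Bochner_Integration.integral_cong) auto
      also have "\<dots> = (\<integral>x. weak_grad ?\<Omega> (U n) x \<bullet> g x \<partial>lebesgue_on ?\<Omega>)"
        using L2_inner_integrable[OF wO \<phi>'(2)] L2_inner_integrable[OF weak_grad(1)[OF UO] \<phi>'(2)]
          weak_grad_AE_eq[OF open_Omega0 UO wO has_weak_gradient_subset[OF w(2) geo(2) Os(1) Ws]]
        by (intro integral_cong_AE) auto
      finally have 1: "(\<integral>x. w x \<bullet> weak_grad (?W n) \<Phi> x \<partial>lebesgue_on (?W n)) =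
        (\<integral>x. weak_grad ?\<Omega> (U n) x \<bullet> g x \<partial>lebesgue_on ?\<Omega>) + (\<integral>x. w x \<bullet> G x \<partial>lebesgue_on E)" .
      have "(\<integral>x. U n x * \<Phi> x \<partial>lebesgue_on (?W n)) = (\<integral>x. U n x * \<Phi> x \<partial>lebesgue_on ?\<Omega>) + (\<integral>x. U n x * \<Phi> x \<partial>lebesgue_on E)"
        unfolding E_def using L2_inner_integrable[OF UL LW(1)]
        by (intro integral_lebesgue_on_split[OF geo(2) Os(1) Ws]) simp
      also have "(\<integral>x. U n x * \<Phi> x \<partial>lebesgue_on ?\<Omega>) = (\<integral>x. U n x * \<phi> x \<partial>lebesgue_on ?\<Omega>)"
        using low by (intro Bochner_Integration.integral_cong) auto
      finally have 2: "(\<integral>x. U n x * \<Phi> x \<partial>lebesgue_on (?W n)) =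
        (\<integral>x. U n x * \<phi> x \<partial>lebesgue_on ?\<Omega>) + (\<integral>x. U n x * \<Phi> x \<partial>lebesgue_on E)" .
      have "(\<integral>x. f x * \<Phi> x \<partial>lebesgue_on (?W n)) = (\<integral>x. f x * \<Phi> x \<partial>lebesgue_on ?\<Omega>) + (\<integral>x. f x * \<Phi> x \<partial>lebesgue_on E)"
        unfolding E_def using L2_inner_integrable[OF LW(3) LW(1)]
        by (intro integral_lebesgue_on_split[OF geo(2) Os(1) Ws]) simp
      also have "(\<integral>x. f x * \<Phi> x \<partial>lebesgue_on ?\<Omega>) = (\<integral>x. f x * \<phi> x \<partial>lebesgue_on ?\<Omega>)"
        using low by (intro Bochner_Integration.integral_cong) auto
      also have "(\<integral>x. f x * \<Phi> x \<partial>lebesgue_on E) = 0"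
      proof (rule integral_eq_zero_AE)
        have "AE x in lebesgue. x \<in> E \<longrightarrow> f x * \<Phi> x = 0"
          using assms(8) by (rule eventually_mono) (auto simp: E_def)
        then show "AE x in lebesgue_on E. f x * \<Phi> x = 0"
          using E(1) by (simp add: AE_restrict_space_iff)
      qed
      finally have 3: "(\<integral>x. f x * \<Phi> x \<partial>lebesgue_on (?W n)) = (\<integral>x. f x * \<phi> x \<partial>lebesgue_on ?\<Omega>)" by simp
      have id: "(\<integral>x. f x * \<phi> x \<partial>lebesgue_on ?\<Omega>) - helmholtz_form ?\<Omega> \<omega> \<phi> (U n) =
        (\<integral>x. w x \<bullet> G x \<partial>lebesgue_on E) - \<omega>\<^sup>2 * (\<integral>x. U n x * \<Phi> x \<partial>lebesgue_on E)"
        using sol(2)[OF \<Phi>W, folded w_def] unfolding 1 2 3 helmholtz_form_def g_def[symmetric]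
        by (simp add: algebra_simps)
      have "\<bar>\<integral>x. w x \<bullet> G x \<partial>lebesgue_on E\<bar> \<le> C * sqrt (\<integral>x. (norm (G x))\<^sup>2 \<partial>lebesgue_on (?S n))"
        by (rule order_trans[OF Cauchy_Schwarz_on_subset[OF w(1) L(2) E(2,3,1) Ws Ss]], rule mult_right_mono)
          (use H1_norm_bounds(2)[of "?W n" "U n", folded w_def] C[of n] in \<open>auto intro!: integral_nonneg_AE\<close>)
      moreover have "\<bar>\<integral>x. U n x * \<Phi> x \<partial>lebesgue_on E\<bar> \<le> C * sqrt (\<integral>x. (norm (\<Phi> x))\<^sup>2 \<partial>lebesgue_on (?S n))"
        by (rule order_trans[OF Cauchy_Schwarz_on_subset[OF UL L(1) E(2,3,1) Ws Ss, unfolded inner_real_def]], rule mult_right_mono)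
          (use H1_norm_bounds(1)[where \<Omega>="?W n" and u="U n"] C[of n] in \<open>auto intro!: integral_nonneg_AE\<close>)
      then have "\<bar>\<omega>\<^sup>2 * (\<integral>x. U n x * \<Phi> x \<partial>lebesgue_on E)\<bar> \<le> \<omega>\<^sup>2 * (C * sqrt (\<integral>x. (norm (\<Phi> x))\<^sup>2 \<partial>lebesgue_on (?S n)))"
        unfolding abs_mult by (intro mult_mono) auto
      ultimately show ?thesis unfolding id R_def by linarith
    qed
    have "(\<lambda>n. (\<integral>x. f x * \<phi> x \<partial>lebesgue_on ?\<Omega>) - helmholtz_form ?\<Omega> \<omega> \<phi> (U n)) \<longlonglongrightarrow> 0"
      by (rule Lim_null_comparison[OF _ R0]) (use small main in \<open>auto elim!: eventually_mono\<close>)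
    moreover have "(\<lambda>n. helmholtz_form ?\<Omega> \<omega> \<phi> (U n)) \<longlonglongrightarrow> helmholtz_form ?\<Omega> \<omega> \<phi> u"
      using assms(15) helmholtz_form_H1_dual[OF open_Omega0 \<phi>] by (simp add: H1_weakly_converges_def)
    then have "(\<lambda>n. (\<integral>x. f x * \<phi> x \<partial>lebesgue_on ?\<Omega>) - helmholtz_form ?\<Omega> \<omega> \<phi> (U n)) \<longlonglongrightarrow>
        (\<integral>x. f x * \<phi> x \<partial>lebesgue_on ?\<Omega>) - helmholtz_form ?\<Omega> \<omega> \<phi> u"
      by (intro tendsto_intros)
    ultimately have "(\<integral>x. f x * \<phi> x \<partial>lebesgue_on ?\<Omega>) - helmholtz_form ?\<Omega> \<omega> \<phi> u = 0"
      using LIMSEQ_unique by blast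
    then show ?thesis by simp
  qed
  then show ?thesis
    using assms(14) unfolding neumann_helmholtz_solution_def helmholtz_form_def by simp
qed

end
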